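(* Let $p$ be prime, $n\ge1$, and $G=G(p,n)$ the Heisenberg group acting on $X=\mathbb{Z}_p^{n+2}$ (column vectors) by matrix–vector multiplication, with associated permutation representation $V=\mathbb{C}^X$. Then an optimal single-query quantum algorithm for symmetric oracle discrimination (identifying the hidden $a\in G$) succeeds with probability $$P_{\rm opt}=1-\frac1p+\frac{2}{p^{n+1}}-\frac{1}{p^{2n+1}},$$ and there is a two-query algorithm that succeeds with probability $1$.
   Context: $G(p,n)$ is the group of $(n+2)\times(n+2)$ matrices over $\mathbb{Z}_p$ with $1$'s on the diagonal whose only other nonzero entries lie in the first row and last column; it is identified with triples $(x,y,z)$, $x,y\in\mathbb{Z}_p^n$, $z\in\mathbb{Z}_p$, where $(1,x,z)$ is the first row and $(z,y,1)^T$ the last column; $|G|=p^{2n+1}$. In the quantum oracle, $a\in G$ acts on $\mathbb{C}^X$ by the permutation matrix $|v\rangle\mapsto|av\rangle$. A $t$-query algorithm consists of $N\ge1$, unit vector $\psi\in V\otimes\mathbb{C}^N$, unitaries $U_1,\dots,U_t$ and a POVM $\{E_x\}_{x\in G}$, producing $\psi_a=U_t(\pi(a)\otimes I)\cdots U_1(\pi(a)\otimes I)\psi$; success probability $\frac1{|G|}\sum_a\langle\psi_a|E_a|\psi_a\rangle$. *)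

theory Defs
  imports Complex_Main "HOL-Computational_Algebra.Primes"
begin

(* The Heisenberg group G(p,n): (n+2)x(n+2) matrices over Z_p (entries in {0..<p},
  represented as functions nat => nat => nat, zero outside the index range {0..<n+2}),
  with 1 on the diagonal and all other nonzero entries in the first row (i = 0) or
  the last column (j = n+1). *)
definition heis :: "nat \<Rightarrow> nat \<Rightarrow> (nat \<Rightarrow> nat \<Rightarrow> nat) set" where
  "heis p n = {M. (\<forall>i j. M i j < p)
      \<and> (\<forall>i j. (n + 2 \<le> i \<or> n + 2 \<le> j) \<longrightarrow> M i j = 0)
      \<and> (\<forall>i<n+2. M i i = 1)
      \<and> (\<forall>i<n+2. \<forall>j<n+2. i \<noteq> j \<and> i \<noteq> 0 \<and> j \<noteq> n + 1 \<longrightarrow> M i j = 0)}"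

definition vecs :: "nat \<Rightarrow> nat \<Rightarrow> (nat \<Rightarrow> nat) set" where
  "vecs p n = {v. (\<forall>i. v i < p) \<and> (\<forall>i. n + 2 \<le> i \<longrightarrow> v i = 0)}"

definition act :: "nat \<Rightarrow> nat \<Rightarrow> (nat \<Rightarrow> nat \<Rightarrow> nat) \<Rightarrow> (nat \<Rightarrow> nat) \<Rightarrow> (nat \<Rightarrow> nat)" where
  "act p n M v = (\<lambda>i. if i < n + 2 then (\<Sum>j<n+2. M i j * v j) mod p else 0)"

type_synonym idx = "(nat \<Rightarrow> nat) \<times> nat"
type_synonym cmat = "idx \<Rightarrow> idx \<Rightarrow> complex"

(* Basis of V \<otimes> C^N: pairs (v,k) with v in X and k < N. *)
definition idxset :: "nat \<Rightarrow> nat \<Rightarrow> nat \<Rightarrow> idx set" where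
  "idxset p n N = vecs p n \<times> {..<N}"

definition mat_app :: "idx set \<Rightarrow> cmat \<Rightarrow> (idx \<Rightarrow> complex) \<Rightarrow> (idx \<Rightarrow> complex)" where
  "mat_app I A \<psi> = (\<lambda>i. \<Sum>j\<in>I. A i j * \<psi> j)"

definition cinner :: "idx set \<Rightarrow> (idx \<Rightarrow> complex) \<Rightarrow> (idx \<Rightarrow> complex) \<Rightarrow> complex" where
  "cinner I \<phi> \<psi> = (\<Sum>i\<in>I. cnj (\<phi> i) * \<psi> i)"

(* Matrix of pi(a) \<otimes> I: |v,k> maps to |a v, k>. *)
definition qoracle :: "nat \<Rightarrow> nat \<Rightarrow> (nat \<Rightarrow> nat \<Rightarrow> nat) \<Rightarrow> cmat" where
  "qoracle p n a = (\<lambda>(w, k) (v, l). if w = act p n a v \<and> k = l then 1 else 0)"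

definition unitary_on :: "idx set \<Rightarrow> cmat \<Rightarrow> bool" where
  "unitary_on I U \<longleftrightarrow> (\<forall>i\<in>I. \<forall>k\<in>I.
      (\<Sum>j\<in>I. cnj (U j i) * U j k) = (if i = k then 1 else 0)
    \<and> (\<Sum>j\<in>I. U i j * cnj (U k j)) = (if i = k then 1 else 0))"

definition psd_on :: "idx set \<Rightarrow> cmat \<Rightarrow> bool" where
  "psd_on I E \<longleftrightarrow> (\<forall>\<phi>. Im (cinner I \<phi> (mat_app I E \<phi>)) = 0
                      \<and> Re (cinner I \<phi> (mat_app I E \<phi>)) \<ge> 0)"

definition povm_on :: "idx set \<Rightarrow> (nat \<Rightarrow> nat \<Rightarrow> nat) set \<Rightarrow> ((nat \<Rightarrow> nat \<Rightarrow> nat) \<Rightarrow> cmat) \<Rightarrow> bool" where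
  "povm_on I G E \<longleftrightarrow> (\<forall>x\<in>G. psd_on I (E x))
     \<and> (\<forall>i\<in>I. \<forall>j\<in>I. (\<Sum>x\<in>G. E x i j) = (if i = j then 1 else 0))"

(* psi_a after k queries: U_k (pi(a)\<otimes>I) ... U_1 (pi(a)\<otimes>I) psi; U_(k+1) is stored at U k. *)
primrec run :: "nat \<Rightarrow> nat \<Rightarrow> nat \<Rightarrow> (idx \<Rightarrow> complex) \<Rightarrow> (nat \<Rightarrow> cmat)
    \<Rightarrow> (nat \<Rightarrow> nat \<Rightarrow> nat) \<Rightarrow> nat \<Rightarrow> (idx \<Rightarrow> complex)" where
  "run p n N \<psi> U a 0 = \<psi>"
| "run p n N \<psi> U a (Suc k) =
     mat_app (idxset p n N) (U k) (mat_app (idxset p n N) (qoracle p n a) (run p n N \<psi> U a k))"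

definition is_query_alg :: "nat \<Rightarrow> nat \<Rightarrow> nat \<Rightarrow> nat \<Rightarrow> (idx \<Rightarrow> complex) \<Rightarrow> (nat \<Rightarrow> cmat)
    \<Rightarrow> ((nat \<Rightarrow> nat \<Rightarrow> nat) \<Rightarrow> cmat) \<Rightarrow> bool" where
  "is_query_alg p n t N \<psi> U E \<longleftrightarrow> N \<ge> 1
     \<and> (\<Sum>i\<in>idxset p n N. (cmod (\<psi> i))\<^sup>2) = 1
     \<and> (\<forall>k<t. unitary_on (idxset p n N) (U k))
     \<and> povm_on (idxset p n N) (heis p n) E"

definition success_prob :: "nat \<Rightarrow> nat \<Rightarrow> nat \<Rightarrow> nat \<Rightarrow> (idx \<Rightarrow> complex) \<Rightarrow> (nat \<Rightarrow> cmat)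
    \<Rightarrow> ((nat \<Rightarrow> nat \<Rightarrow> nat) \<Rightarrow> cmat) \<Rightarrow> real" where
  "success_prob p n t N \<psi> U E =
     (1 / real (card (heis p n))) *
     (\<Sum>a\<in>heis p n. Re (cinner (idxset p n N) (run p n N \<psi> U a t)
                          (mat_app (idxset p n N) (E a) (run p n N \<psi> U a t))))"

end

theory Submission
  imports Defs "HOL-Analysis.Convex"
begin

text \<open>
  A matrix \<open>a\<close> of the group is a pair of its first row \<open>r = (x, z)\<close> and its last column \<open>y\<close>,
  and \<open>\<omega>\<close> is a primitive \<open>p\<close>-th root of unity.

  Upper bound for one query. Expanding the congruence \<open>(a v)\<^sub>0 = w\<^sub>0\<close> in characters shows that every entry
  \<open>[w = a v]\<close> of the oracle, as a function of \<open>a\<close>, lies in the span of the functions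
  \<open>\<omega>\<^bsup>r \<cdot> u\<^esup> [y = q]\<close> with \<open>u\<^sub>n\<^sub>+\<^sub>1 \<noteq> 0\<close> or \<open>u = 0\<close>, and \<open>\<omega>\<^bsup>r \<cdot> u\<^esup>\<close> with \<open>u\<^sub>n\<^sub>+\<^sub>1 = 0\<close>, \<open>u \<noteq> 0\<close>.
  There are \<open>D = p\<^sup>n (p\<^bsup>n+1\<^esup> - p\<^sup>n + 1) + p\<^sup>n - 1\<close> of them, so the final states span a space of
  dimension at most \<open>D\<close>, and summing a POVM over an orthonormal basis of it bounds the total
  success weight by \<open>D\<close>.

  Algorithms. If \<open>\<Sum>\<^sub>a |\<langle>\<psi>\<^sub>a, f\<rangle>|\<^sup>2 \<le> \<Lambda> |f|\<^sup>2\<close> for the final states \<open>\<psi>\<^sub>a\<close>, then the operators \<open>|\<psi>\<^sub>a\<rangle>\<langle>\<psi>\<^sub>a| / \<Lambda>\<close>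
  sum to at most the identity, and completing them to a POVM gives success probability at least
  \<open>1 / \<Lambda>\<close>. Querying the state \<open>\<Sum>\<^sub>u c\<^sub>u \<Sum>\<^sub>s \<omega>\<^bsup>-s\<^esup> |s, u\<rangle> \<otimes> |u\<rangle>\<close> with \<open>c\<^sub>u\<^sup>2 = p\<^sup>n\<close> or \<open>1\<close> according to
  whether \<open>u\<^sub>n\<^sub>+\<^sub>1 \<noteq> 0\<close>, the label \<open>u = 0\<close> being used for the classical query of the last unit vector
  (without the phase and with \<open>c\<^sub>0\<^sup>2 = p\<^sup>n\<close>), attains \<open>\<Lambda> = |G| / D\<close> by Parseval.
  With two queries, the first one reads off \<open>y\<close> and \<open>z\<close> classically, and the second one, applied after a
  swap to a uniform superposition with phases, reads off \<open>x\<close> as in the Bernstein-Vazirani algorithm; here \<open>\<Lambda> = 1\<close>.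
\<close>

section \<open>Measurements and states\<close>

lemma sesq_sum:
  fixes c :: "'b \<Rightarrow> complex"
  assumes "\<And>i. i \<in> I \<Longrightarrow> f i = (\<Sum>j\<in>J. c j * q j i)"
  shows "cinner I f (mat_app I E f) = (\<Sum>j\<in>J. \<Sum>k\<in>J. cnj (c j) * c k * cinner I (q j) (mat_app I E (q k)))"
proof -
  have "cinner I f (mat_app I E f) = (\<Sum>i\<in>I. \<Sum>l\<in>I. \<Sum>j\<in>J. \<Sum>k\<in>J. cnj (c j) * c k * (cnj (q j i) * (E i l * q k l)))"
  proof -
    have "cnj (f i) * (E i l * f l) = (\<Sum>j\<in>J. \<Sum>k\<in>J. cnj (c j) * c k * (cnj (q j i) * (E i l * q k l)))"
      if "i \<in> I" "l \<in> I" for i l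
    proof -
      have "cnj (f i) * (E i l * f l) = E i l * ((\<Sum>j\<in>J. cnj (c j) * cnj (q j i)) * (\<Sum>k\<in>J. c k * q k l))"
        using that by (simp add: assms mult_ac)
      also have "\<dots> = (\<Sum>j\<in>J. \<Sum>k\<in>J. E i l * ((cnj (c j) * cnj (q j i)) * (c k * q k l)))"
        by (subst sum_product) (simp only: sum_distrib_left)
      finally show ?thesis by (simp add: mult_ac)
    qed
    then show ?thesis unfolding cinner_def mat_app_def by (simp add: sum_distrib_left)
  qed
  also have "\<dots> = (\<Sum>i\<in>I. \<Sum>j\<in>J. \<Sum>l\<in>I. \<Sum>k\<in>J. cnj (c j) * c k * (cnj (q j i) * (E i l * q k l)))"
    by (intro sum.cong refl sum.swap)
  also have "\<dots> = (\<Sum>j\<in>J. \<Sum>i\<in>I. \<Sum>k\<in>J. \<Sum>l\<in>I. cnj (c j) * c k * (cnj (q j i) * (E i l * q k l)))"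
    by (subst sum.swap) (intro sum.cong refl sum.swap)
  also have "\<dots> = (\<Sum>j\<in>J. \<Sum>k\<in>J. \<Sum>i\<in>I. \<Sum>l\<in>I. cnj (c j) * c k * (cnj (q j i) * (E i l * q k l)))"
    by (intro sum.cong refl sum.swap)
  finally show ?thesis
    unfolding cinner_def mat_app_def by (simp add: sum_distrib_left)
qed

lemma sesq_diff:
  "cinner I (\<lambda>i. a * f i - b * g i) (mat_app I E (\<lambda>i. a * f i - b * g i)) =
     cnj a * a * cinner I f (mat_app I E f) + cnj b * b * cinner I g (mat_app I E g)
     - cnj a * b * cinner I f (mat_app I E g) - cnj b * a * cinner I g (mat_app I E f)"
  unfolding cinner_def mat_app_def
  by (simp add: algebra_simps sum_distrib_left sum_distrib_right sum.distrib sum_subtractf)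

text \<open>
  Lagrange's identity: the difference of the two sides is half the sum over \<open>j\<close>, \<open>k\<close> of the
  values of the form at \<open>cnj (c k) q\<^sub>j - cnj (c j) q\<^sub>k\<close>.
\<close>
lemma psd_combination_le:
  fixes c :: "'b \<Rightarrow> complex"
  assumes psd: "psd_on I E" 
    and f: "\<And>i. i \<in> I \<Longrightarrow> f i = (\<Sum>j\<in>J. c j * q j i)"
  shows "Re (cinner I f (mat_app I E f)) \<le> (\<Sum>j\<in>J. (cmod (c j))\<^sup>2) * (\<Sum>j\<in>J. Re (cinner I (q j) (mat_app I E (q j))))"
proof -
  define B where "B = (\<lambda>j k. cinner I (q j) (mat_app I E (q k)))"
  have nn: "0 \<le> Re (cnj (cnj (c k)) * cnj (c k) * B j j + cnj (cnj (c j)) * cnj (c j) * B k k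
     - cnj (cnj (c k)) * cnj (c j) * B j k - cnj (cnj (c j)) * cnj (c k) * B k j)" for j k
    using psd unfolding psd_on_def B_def sesq_diff[symmetric] by blast
  have "0 \<le> (\<Sum>j\<in>J. \<Sum>k\<in>J. Re (cnj (cnj (c k)) * cnj (c k) * B j j + cnj (cnj (c j)) * cnj (c j) * B k k
     - cnj (cnj (c k)) * cnj (c j) * B j k - cnj (cnj (c j)) * cnj (c k) * B k j))"
    by (intro sum_nonneg nn)
  also have "\<dots> = (\<Sum>j\<in>J. \<Sum>k\<in>J. ((cmod (c k))\<^sup>2 * Re (B j j) + (cmod (c j))\<^sup>2 * Re (B k k))
       - Re (cnj (c j) * c k * B j k) - Re (cnj (c k) * c j * B k j))"
  proof (intro sum.cong refl)
    fix j k
    have 1: "z * cnj z = complex_of_real ((cmod z)\<^sup>2)" for z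
      by (simp only: complex_norm_square)
    have 2: "Re (complex_of_real x * z) = x * Re z" for x z by simp
    show "Re (cnj (cnj (c k)) * cnj (c k) * B j j + cnj (cnj (c j)) * cnj (c j) * B k k
     - cnj (cnj (c k)) * cnj (c j) * B j k - cnj (cnj (c j)) * cnj (c k) * B k j) = 
      ((cmod (c k))\<^sup>2 * Re (B j j) + (cmod (c j))\<^sup>2 * Re (B k k))
       - Re (cnj (c j) * c k * B j k) - Re (cnj (c k) * c j * B k j)"
      by (simp only: 1 2 plus_complex.sel minus_complex.sel complex_cnj_cnj mult.assoc[of "cnj _"] mult.assoc[of "c _"]) (simp add: mult_ac)
  qed
  also have "\<dots> = 2 * (\<Sum>j\<in>J. (cmod (c j))\<^sup>2) * (\<Sum>j\<in>J. Re (B j j)) 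
      - 2 * Re (\<Sum>j\<in>J. \<Sum>k\<in>J. cnj (c j) * c k * B j k)"
  proof -
    have s: "(\<Sum>j\<in>J. \<Sum>k\<in>J. F k j) = (\<Sum>j\<in>J. \<Sum>k\<in>J. F j k)" for F :: "'b \<Rightarrow> 'b \<Rightarrow> real"
      by (rule sum.swap)
    have "(\<Sum>j\<in>J. \<Sum>k\<in>J. (cmod (c k))\<^sup>2 * Re (B j j)) = (\<Sum>j\<in>J. (cmod (c j))\<^sup>2) * (\<Sum>j\<in>J. Re (B j j))"
      by (subst sum.swap) (simp add: sum_product)
    moreover have "(\<Sum>j\<in>J. \<Sum>k\<in>J. (cmod (c j))\<^sup>2 * Re (B k k)) = (\<Sum>j\<in>J. (cmod (c j))\<^sup>2) * (\<Sum>j\<in>J. Re (B j j))"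
      by (simp add: sum_product)
    moreover have "(\<Sum>j\<in>J. \<Sum>k\<in>J. Re (cnj (c k) * c j * B k j)) = Re (\<Sum>j\<in>J. \<Sum>k\<in>J. cnj (c j) * c k * B j k)"
      by (subst s[of "\<lambda>j k. Re (cnj (c j) * c k * B j k)"]) (simp only: Re_sum)
    moreover have "(\<Sum>j\<in>J. \<Sum>k\<in>J. Re (cnj (c j) * c k * B j k)) = Re (\<Sum>j\<in>J. \<Sum>k\<in>J. cnj (c j) * c k * B j k)"
      by (simp only: Re_sum)
    ultimately show ?thesis by (simp only: sum.distrib sum_subtractf)
  qed
  moreover have "cinner I f (mat_app I E f) = (\<Sum>j\<in>J. \<Sum>k\<in>J. cnj (c j) * c k * B j k)"
    unfolding B_def by (rule sesq_sum) (rule f)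
  ultimately show ?thesis by (simp only: B_def)
qed

lemma cinner_self: "cinner I f f = complex_of_real (\<Sum>i\<in>I. (cmod (f i))\<^sup>2)"
  unfolding cinner_def of_real_sum complex_norm_square by (simp only: mult.commute)

text \<open>Induction on \<open>T\<close>: subtracting from a new vector its components along the
  old \<open>q\<close> leaves a residue orthogonal to all of them. If the residue vanishes on
  \<open>I\<close>, the old family already suffices; otherwise it is normalised and appended. The
  vectors \<open>\<phi> t\<close> may be dependent, so only \<open>r \<le> card T\<close>
  results.\<close>

lemma gram_schmidt:
  fixes \<phi> :: "'t \<Rightarrow> idx \<Rightarrow> complex"
  assumes "finite T" and fI: "finite I"
  shows "\<exists>(r::nat) q. r \<le> card T \<and> (\<forall>j<r. \<forall>k<r. cinner I (q j) (q k) = (if j = k then 1 else 0))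
     \<and> (\<forall>t\<in>T. \<exists>c. \<forall>i\<in>I. \<phi> t i = (\<Sum>j<r. c j * q j i))"
  using assms(1)
proof (induction T)
  case empty
  show ?case by (intro exI[of _ 0]) simp
next
  case (insert t T)
  then obtain r :: nat and q where r: "r \<le> card T"
    and on: "\<And>j k. j < r \<Longrightarrow> k < r \<Longrightarrow> cinner I (q j) (q k) = (if j = k then 1 else 0)"
    and sp: "\<And>s. s \<in> T \<Longrightarrow> \<exists>c. \<forall>i\<in>I. \<phi> s i = (\<Sum>j<r. c j * q j i)"
    by blast
  define d where "d = (\<lambda>j. cinner I (q j) (\<phi> t))"
  define \<rho> where "\<rho> = (\<lambda>i. \<phi> t i - (\<Sum>j<r. d j * q j i))"
  define m where "m = (\<Sum>i\<in>I. (cmod (\<rho> i))\<^sup>2)"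
  show ?case
  proof (cases "m = 0")
    case True
    then have "\<And>i. i \<in> I \<Longrightarrow> \<rho> i = 0"
      unfolding m_def using fI by (simp add: sum_nonneg_eq_0_iff)
    then have "\<forall>i\<in>I. \<phi> t i = (\<Sum>j<r. d j * q j i)" by (simp add: \<rho>_def)
    with r on sp show ?thesis
      using insert.hyps by (intro exI[of _ r] exI[of _ q]) (auto simp: card_insert_if)
  next
    case False
    have m0: "m > 0" using False unfolding m_def by (simp add: order_less_le sum_nonneg)
    have orth: "cinner I (q j) \<rho> = 0" if j: "j < r" for j
    proof -
      have "cinner I (q j) \<rho> = d j - (\<Sum>i\<in>I. \<Sum>k<r. d k * (cnj (q j i) * q k i))"
        unfolding \<rho>_def d_def cinner_def
        by (simp add: algebra_simps sum_subtractf sum_distrib_left)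
      also have "(\<Sum>i\<in>I. \<Sum>k<r. d k * (cnj (q j i) * q k i)) = (\<Sum>k<r. d k * cinner I (q j) (q k))"
        unfolding cinner_def by (subst sum.swap) (simp add: sum_distrib_left)
      also have "\<dots> = (\<Sum>k<r. if j = k then d k else 0)"
        using on j by (intro sum.cong) auto
      also have "\<dots> = d j" using j by simp
      finally show ?thesis by simp
    qed
    have orth': "cinner I \<rho> (q j) = 0" if j: "j < r" for j
      using arg_cong[OF orth[OF j], of cnj] unfolding cinner_def by (simp add: mult.commute)
    define q' where "q' = (\<lambda>j. if j = r then (\<lambda>i. \<rho> i / complex_of_real (sqrt m)) else q j)"
    have q'r: "cinner I (q' r) (q' r) = 1"
    proof -
      have "cinner I (q' r) (q' r) = cinner I \<rho> \<rho> / complex_of_real (sqrt m * sqrt m)"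
        unfolding cinner_def q'_def by (simp add: sum_divide_distrib del: real_sqrt_mult_self)
      then show ?thesis using m0 unfolding cinner_self m_def[symmetric] by simp
    qed
    have q'1: "cinner I (q' j) (q' r) = 0" and q'2: "cinner I (q' r) (q' j) = 0" if "j < r" for j
      using orth[OF that] orth'[OF that] that unfolding q'_def cinner_def
      by (simp_all add: sum_divide_distrib[symmetric])
    have q'3: "q' j = q j" if "j < r" for j using that by (simp add: q'_def)
    have "cinner I (q' j) (q' k) = (if j = k then 1 else 0)" if "j < Suc r" "k < Suc r" for j k
      using that q'r q'1 q'2 q'3 on by (auto simp: less_Suc_eq)
    moreover have "\<exists>c. \<forall>i\<in>I. \<phi> s i = (\<Sum>j<Suc r. c j * q' j i)" if s: "s \<in> insert t T" for s
    proof (cases "s = t")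
      case True
      \<comment> \<open>The new basis vector is the residue divided by its norm
        \<open>sqrt m\<close>, so it enters with coefficient \<open>sqrt m\<close>.\<close>
      show ?thesis
        by (rule exI[of _ "d(r := complex_of_real (sqrt m))"])
           (use m0 True in \<open>simp add: q'_def \<rho>_def\<close>)
    next
      case False
      then obtain c where "\<forall>i\<in>I. \<phi> s i = (\<Sum>j<r. c j * q j i)" using sp s by blast
      then show ?thesis
        by (intro exI[of _ "c(r := 0)"]) (simp add: q'_def)
    qed
    ultimately show ?thesis
      using r insert.hyps by (intro exI[of _ "Suc r"] exI[of _ q']) auto
  qed
qed

text \<open>Completeness of the POVM in quadratic form, valid for vectors of any norm. It serves
  both for the basis vectors in the upper bound and for the total probability 1.\<close>

lemma povm_sum:
  assumes "povm_on I G E" and fI: "finite I"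
  shows "(\<Sum>a\<in>G. Re (cinner I f (mat_app I (E a) f))) = (\<Sum>i\<in>I. (cmod (f i))\<^sup>2)"
proof -
  have "(\<Sum>a\<in>G. cinner I f (mat_app I (E a) f)) = (\<Sum>a\<in>G. \<Sum>i\<in>I. \<Sum>l\<in>I. cnj (f i) * f l * E a i l)"
    unfolding cinner_def mat_app_def by (simp add: sum_distrib_left mult_ac)
  also have "\<dots> = (\<Sum>i\<in>I. \<Sum>l\<in>I. \<Sum>a\<in>G. cnj (f i) * f l * E a i l)"
    by (subst sum.swap) (intro sum.cong refl sum.swap)
  also have "\<dots> = (\<Sum>i\<in>I. \<Sum>l\<in>I. cnj (f i) * f l * (\<Sum>a\<in>G. E a i l))"
    by (simp add: sum_distrib_left)
  also have "\<dots> = (\<Sum>i\<in>I. \<Sum>l\<in>I. if i = l then cnj (f i) * f l else 0)"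
    using assms unfolding povm_on_def by (intro sum.cong refl) auto
  also have "\<dots> = cinner I f f"
    unfolding cinner_def using fI by simp
  finally show ?thesis unfolding cinner_self
    by (metis Re_complex_of_real Re_sum)
qed

text \<open>In an orthonormal basis \<open>q\<close> of the span, a unit vector
  \<open>\<psi> a\<close> has coefficients of total square 1, so \<open>psd_combination_le\<close>
  bounds its weight under \<open>E a\<close> by the trace of \<open>E a\<close> over that basis.
  Summed over \<open>a\<close>, completeness of the POVM turns each basis vector into a contribution
  1, and the basis has at most \<open>card T\<close> elements.\<close>

lemma discrimination_bound:
  fixes \<phi> :: "'t \<Rightarrow> idx \<Rightarrow> complex"
  assumes povm: "povm_on I G E" and fI: "finite I" and fT: "finite T"
    and unit: "\<And>a. a \<in> G \<Longrightarrow> (\<Sum>i\<in>I. (cmod (\<psi> a i))\<^sup>2) = 1"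
    and sp: "\<And>a i. a \<in> G \<Longrightarrow> i \<in> I \<Longrightarrow> \<psi> a i = (\<Sum>t\<in>T. h t a * \<phi> t i)"
  shows "(\<Sum>a\<in>G. Re (cinner I (\<psi> a) (mat_app I (E a) (\<psi> a)))) \<le> real (card T)"
proof -
  obtain r :: nat and q where r: "r \<le> card T"
    and on: "\<And>j k. j < r \<Longrightarrow> k < r \<Longrightarrow> cinner I (q j) (q k) = (if j = k then 1 else 0)"
    and sq: "\<forall>t\<in>T. \<exists>c. \<forall>i\<in>I. \<phi> t i = (\<Sum>j<r. c j * q j i)"
    using gram_schmidt[OF fT fI, of \<phi>] by blast
  obtain c where c: "\<And>t i. t \<in> T \<Longrightarrow> i \<in> I \<Longrightarrow> \<phi> t i = (\<Sum>j<r. c t j * q j i)"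
    using bchoice[OF sq] by blast
  have "Re (cinner I (\<psi> a) (mat_app I (E a) (\<psi> a))) \<le> (\<Sum>j<r. Re (cinner I (q j) (mat_app I (E a) (q j))))"
    if a: "a \<in> G" for a
  proof -
    define d where "d = (\<lambda>j. \<Sum>t\<in>T. h t a * c t j)"
    have d: "\<psi> a i = (\<Sum>j<r. d j * q j i)" if i: "i \<in> I" for i
    proof -
      have "\<psi> a i = (\<Sum>t\<in>T. \<Sum>j<r. h t a * c t j * q j i)"
        using sp[OF a i] c i by (simp add: sum_distrib_left mult.assoc)
      also have "\<dots> = (\<Sum>j<r. d j * q j i)"
        unfolding d_def by (subst sum.swap) (simp add: sum_distrib_right)
      finally show ?thesis .
    qed
    \<comment> \<open>With the identity matrix in place of \<open>E\<close>, \<open>sesq_sum\<close>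
      also expands the plain inner product.\<close>
    have id: "mat_app I (\<lambda>i j. if i = j then 1 else 0) f i = f i" if "i \<in> I" for f i
      using that fI unfolding mat_app_def by (simp add: if_distrib[of "\<lambda>x. x * _"] cong: if_cong)
    have id': "cinner I f (mat_app I (\<lambda>i j. if i = j then 1 else 0) g) = cinner I f g" for f g
      unfolding cinner_def using id by simp
    have "cinner I (\<psi> a) (\<psi> a) = (\<Sum>j<r. \<Sum>k<r. cnj (d j) * d k * cinner I (q j) (q k))"
      using sesq_sum[of I "\<psi> a", OF d, where E="\<lambda>i j. if i = j then 1 else 0"] by (simp add: id')
    also have "\<dots> = (\<Sum>j<r. \<Sum>k<r. if j = k then cnj (d j) * d k else 0)"
      using on by (intro sum.cong refl) auto
    also have "\<dots> = complex_of_real (\<Sum>j<r. (cmod (d j))\<^sup>2)"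
      unfolding of_real_sum complex_norm_square by (simp add: mult.commute)
    finally have "(\<Sum>j<r. (cmod (d j))\<^sup>2) = 1"
      unfolding cinner_self using unit[OF a] by (metis of_real_eq_iff)
    then show ?thesis
      using psd_combination_le[of I "E a" "\<psi> a", OF _ d] povm a unfolding povm_on_def by auto
  qed
  then have "(\<Sum>a\<in>G. Re (cinner I (\<psi> a) (mat_app I (E a) (\<psi> a)))) \<le>
     (\<Sum>a\<in>G. \<Sum>j<r. Re (cinner I (q j) (mat_app I (E a) (q j))))"
    by (rule sum_mono)
  also have "\<dots> = (\<Sum>j<r. \<Sum>i\<in>I. (cmod (q j i))\<^sup>2)"
    by (subst sum.swap) (simp add: povm_sum[OF povm fI])
  also have "\<dots> = (\<Sum>j<r. 1)"
  proof (rule sum.cong)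
    fix j assume "j \<in> {..<r}"
    then have "cinner I (q j) (q j) = 1" using on by simp
    then show "(\<Sum>i\<in>I. (cmod (q j i))\<^sup>2) = 1"
      unfolding cinner_self by (metis of_real_1 of_real_eq_iff)
  qed simp
  also have "\<dots> \<le> real (card T)" using r by simp
  finally show ?thesis .
qed

text \<open>The rank-one operators of the vectors \<open>\<mu> a\<close> sum to at most the
  identity. The deficit is positive semidefinite and is added to the single outcome
  \<open>a0\<close>, which makes the family complete and can only increase the weight of an
  outcome.\<close>

lemma povm_from_frame:
  fixes \<mu> :: "(nat \<Rightarrow> nat \<Rightarrow> nat) \<Rightarrow> idx \<Rightarrow> complex"
  assumes fI: "finite I" and fG: "finite G" and a0: "a0 \<in> G"
    and fr: "\<And>f. (\<Sum>a\<in>G. (cmod (cinner I (\<mu> a) f))\<^sup>2) \<le> (\<Sum>i\<in>I. (cmod (f i))\<^sup>2)"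
  shows "\<exists>E. povm_on I G E \<and>
     (\<forall>a\<in>G. \<forall>f. (cmod (cinner I (\<mu> a) f))\<^sup>2 \<le> Re (cinner I f (mat_app I (E a) f)))"
proof -
  define E :: "(nat \<Rightarrow> nat \<Rightarrow> nat) \<Rightarrow> cmat" where
    "E = (\<lambda>a i j. \<mu> a i * cnj (\<mu> a j) + (if a = a0 then (if i = j then 1 else 0) - (\<Sum>b\<in>G. \<mu> b i * cnj (\<mu> b j)) else 0))"
  have rank1: "(\<Sum>i\<in>I. \<Sum>j\<in>I. cnj (f i) * (\<mu> a i * cnj (\<mu> a j)) * f j) = complex_of_real ((cmod (cinner I (\<mu> a) f))\<^sup>2)" for a f
  proof -
    have "(\<Sum>i\<in>I. \<Sum>j\<in>I. cnj (f i) * (\<mu> a i * cnj (\<mu> a j)) * f j) = cnj (cinner I (\<mu> a) f) * cinner I (\<mu> a) f"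
      unfolding cinner_def cnj_sum sum_product by (simp only: complex_cnj_mult complex_cnj_cnj mult_ac)
    then show ?thesis by (simp only: complex_norm_square mult.commute)
  qed
  have ex: "cinner I f (mat_app I (E a) f) = complex_of_real ((cmod (cinner I (\<mu> a) f))\<^sup>2
     + (if a = a0 then (\<Sum>i\<in>I. (cmod (f i))\<^sup>2) - (\<Sum>a\<in>G. (cmod (cinner I (\<mu> a) f))\<^sup>2) else 0))" for a f
  proof -
    have "cinner I f (mat_app I (E a) f) = (\<Sum>i\<in>I. \<Sum>j\<in>I. cnj (f i) * (\<mu> a i * cnj (\<mu> a j)) * f j)
       + (if a = a0 then (\<Sum>i\<in>I. \<Sum>j\<in>I. cnj (f i) * (if i = j then 1 else 0) * f j)
          - (\<Sum>i\<in>I. \<Sum>j\<in>I. \<Sum>b\<in>G. cnj (f i) * (\<mu> b i * cnj (\<mu> b j)) * f j) else 0)"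
      unfolding cinner_def mat_app_def E_def
      by (simp add: algebra_simps sum_distrib_left sum_distrib_right sum.distrib sum_subtractf)
    moreover have "(\<Sum>i\<in>I. \<Sum>j\<in>I. cnj (f i) * (if i = j then 1 else 0) * f j) = cinner I f f"
      unfolding cinner_def using fI
      by (simp add: if_distrib[of "\<lambda>x. x * _"] if_distrib[of "\<lambda>x. _ * x"] cong: if_cong)
    moreover have "(\<Sum>i\<in>I. \<Sum>j\<in>I. \<Sum>b\<in>G. cnj (f i) * (\<mu> b i * cnj (\<mu> b j)) * f j)
       = (\<Sum>b\<in>G. \<Sum>i\<in>I. \<Sum>j\<in>I. cnj (f i) * (\<mu> b i * cnj (\<mu> b j)) * f j)"
    proof -
      have "(\<Sum>i\<in>I. \<Sum>j\<in>I. \<Sum>b\<in>G. cnj (f i) * (\<mu> b i * cnj (\<mu> b j)) * f j)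
        = (\<Sum>i\<in>I. \<Sum>b\<in>G. \<Sum>j\<in>I. cnj (f i) * (\<mu> b i * cnj (\<mu> b j)) * f j)"
        by (intro sum.cong refl sum.swap)
      also have "\<dots> = (\<Sum>b\<in>G. \<Sum>i\<in>I. \<Sum>j\<in>I. cnj (f i) * (\<mu> b i * cnj (\<mu> b j)) * f j)"
        by (rule sum.swap)
      finally show ?thesis .
    qed
    ultimately show ?thesis
      by (simp only: rank1 cinner_self) simp
  qed
  have 1: "(cmod (cinner I (\<mu> a) f))\<^sup>2 \<le> Re (cinner I f (mat_app I (E a) f))" for a f
    unfolding ex using fr[of f] by simp
  have "psd_on I (E a)" for a
    unfolding psd_on_def
  proof (intro allI conjI)
    fix f
    show "Im (cinner I f (mat_app I (E a) f)) = 0" unfolding ex by simp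
    show "0 \<le> Re (cinner I f (mat_app I (E a) f))" by (rule order_trans[OF _ 1]) simp
  qed
  moreover have "(\<Sum>a\<in>G. E a i j) = (if i = j then 1 else 0)" for i j
    using a0 fG by (simp add: E_def sum.distrib)
  ultimately have "povm_on I G E" unfolding povm_on_def by blast
  with 1 show ?thesis by blast
qed

section \<open>Permutation matrices and norm preservation\<close>

definition perm_mat :: "(idx \<Rightarrow> idx) \<Rightarrow> cmat" where
  "perm_mat \<sigma> = (\<lambda>i j. if i = \<sigma> j then 1 else 0)"

lemma perm_mat_unitary:
  assumes fI: "finite I" and b: "bij_betw \<sigma> I I"
  shows "unitary_on I (perm_mat \<sigma>)"
  unfolding unitary_on_def
proof (intro ballI conjI)
  fix i k assume i: "i \<in> I" and k: "k \<in> I"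
  have si: "\<sigma> i \<in> I" using b i by (auto simp: bij_betw_def)
  have "(\<Sum>j\<in>I. cnj (perm_mat \<sigma> j i) * perm_mat \<sigma> j k) = (\<Sum>j\<in>I. if j = \<sigma> i then (if \<sigma> i = \<sigma> k then 1 else 0) else 0)"
    unfolding perm_mat_def by (intro sum.cong) auto
  also have "\<dots> = (if i = k then 1 else 0)"
    using si fI b i k by (auto simp: bij_betw_def inj_on_def)
  finally show "(\<Sum>j\<in>I. cnj (perm_mat \<sigma> j i) * perm_mat \<sigma> j k) = (if i = k then 1 else 0)" .
  have "(\<Sum>j\<in>I. perm_mat \<sigma> i j * cnj (perm_mat \<sigma> k j)) = (\<Sum>j\<in>I. if i = \<sigma> j \<and> k = \<sigma> j then 1 else 0)"
    unfolding perm_mat_def by (intro sum.cong) auto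
  also have "\<dots> = (\<Sum>j\<in>I. if i = j \<and> k = j then 1 else 0)"
    by (rule sum.reindex_bij_betw[OF b])
  also have "\<dots> = (\<Sum>j\<in>I. if i = j then (if k = i then 1 else 0) else 0)"
    by (intro sum.cong) auto
  finally show "(\<Sum>j\<in>I. perm_mat \<sigma> i j * cnj (perm_mat \<sigma> k j)) = (if i = k then 1 else 0)"
    using i fI by auto
qed

lemma perm_mat_app:
  assumes fI: "finite I" and b: "bij_betw \<sigma> I I" and j: "j \<in> I"
  shows "mat_app I (perm_mat \<sigma>) f (\<sigma> j) = f j"
proof -
  have "mat_app I (perm_mat \<sigma>) f (\<sigma> j) = (\<Sum>l\<in>I. if j = l then f l else 0)"
    unfolding mat_app_def perm_mat_def using b j by (intro sum.cong) (auto simp: bij_betw_def inj_on_def)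
  then show ?thesis using fI j by simp
qed

lemma cinner_perm_mat_app:
  assumes fI: "finite I" and b: "bij_betw \<sigma> I I"
  shows "cinner I (mat_app I (perm_mat \<sigma>) f) g = (\<Sum>j\<in>I. cnj (f j) * g (\<sigma> j))"
  unfolding cinner_def
  by (subst sum.reindex_bij_betw[OF b, symmetric]) (simp add: perm_mat_app[OF assms])

lemma unitary_norm:
  assumes fI: "finite I" and U: "unitary_on I U"
  shows "(\<Sum>i\<in>I. (cmod (mat_app I U f i))\<^sup>2) = (\<Sum>i\<in>I. (cmod (f i))\<^sup>2)"
proof -
  have "cinner I (mat_app I U f) (mat_app I U f) = (\<Sum>i\<in>I. \<Sum>j\<in>I. \<Sum>k\<in>I. cnj (f j) * f k * (cnj (U i j) * U i k))"
    unfolding cinner_def mat_app_def cnj_sum sum_product by (simp only: complex_cnj_mult mult_ac)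
  also have "\<dots> = (\<Sum>j\<in>I. \<Sum>i\<in>I. \<Sum>k\<in>I. cnj (f j) * f k * (cnj (U i j) * U i k))"
    by (rule sum.swap)
  also have "\<dots> = (\<Sum>j\<in>I. \<Sum>k\<in>I. \<Sum>i\<in>I. cnj (f j) * f k * (cnj (U i j) * U i k))"
    by (intro sum.cong refl sum.swap)
  also have "\<dots> = (\<Sum>j\<in>I. \<Sum>k\<in>I. cnj (f j) * f k * (\<Sum>i\<in>I. cnj (U i j) * U i k))"
    by (simp add: sum_distrib_left)
  also have "\<dots> = (\<Sum>j\<in>I. \<Sum>k\<in>I. if j = k then cnj (f j) * f k else 0)"
    using U unfolding unitary_on_def by (intro sum.cong refl) auto
  also have "\<dots> = cinner I f f" unfolding cinner_def using fI by simp
  finally show ?thesis unfolding cinner_self by (metis of_real_eq_iff)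
qed

section \<open>Characters and the Heisenberg group\<close>

definition zvec :: "nat \<Rightarrow> nat set \<Rightarrow> (nat \<Rightarrow> nat) set" where
  "zvec p J = {f. (\<forall>i. f i < p) \<and> (\<forall>i. i \<notin> J \<longrightarrow> f i = 0)}"

text \<open>Vectors are functions vanishing off their index set, so forgetting a coordinate means
  resetting it to 0 and adding one is a function update. Cardinalities and character sums follow
  from this by induction on the index set.\<close>

lemma sum_zvec_insert:
  assumes "j \<notin> J"
  shows "(\<Sum>f\<in>zvec p (insert j J). F f) = (\<Sum>f\<in>zvec p J. \<Sum>z<p. F (f(j := z)))"
  unfolding sum.cartesian_product
  by (rule sum.reindex_bij_witness[of _ "\<lambda>(f, z). f(j := z)" "\<lambda>f. (f(j := 0), f j)"])
     (use assms in \<open>force simp: zvec_def fun_eq_iff\<close>)+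

lemma zvec_empty: "0 < p \<Longrightarrow> zvec p {} = {\<lambda>_. 0}"
  by (auto simp: zvec_def)

lemma zvec_mono: "J \<subseteq> K \<Longrightarrow> zvec p J \<subseteq> zvec p K"
  by (auto simp: zvec_def)

lemma zero_in_zvec: "0 < p \<Longrightarrow> (\<lambda>_. 0) \<in> zvec p J"
  by (simp add: zvec_def)

lemma zvec_upd: "f \<in> zvec p J \<Longrightarrow> z < p \<Longrightarrow> f(j := z) \<in> zvec p (insert j J)"
  by (auto simp: zvec_def)

lemma finite_zvec: "finite J \<Longrightarrow> 0 < p \<Longrightarrow> finite (zvec p J)"
proof (induction J rule: finite_induct)
  case empty
  then show ?case by (simp add: zvec_empty)
next
  case (insert j J)
  have "f \<in> (\<lambda>(f, z). f(j := z)) ` (zvec p J \<times> {..<p})" if "f \<in> zvec p (insert j J)" for f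
    using that by (intro image_eqI[of _ _ "(f(j := 0), f j)"]) (force simp: zvec_def)+
  then have "zvec p (insert j J) \<subseteq> (\<lambda>(f, z). f(j := z)) ` (zvec p J \<times> {..<p})" by blast
  then show ?case using insert by (meson finite_SigmaI finite_imageI finite_lessThan finite_subset)
qed

lemma card_zvec: "finite J \<Longrightarrow> 0 < p \<Longrightarrow> card (zvec p J) = p ^ card J"
proof (induction J rule: finite_induct)
  case empty
  then show ?case by (simp add: zvec_empty)
next
  case (insert j J)
  have "card (zvec p (insert j J)) = (\<Sum>f\<in>zvec p (insert j J). 1)" by simp
  also have "\<dots> = card (zvec p J) * p"
    by (subst sum_zvec_insert[OF insert.hyps(2)]) simp
  finally show ?case using insert by simp
qed

section \<open>Additive characters, orthogonality and Parseval\<close>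

definition zchar :: "nat \<Rightarrow> int \<Rightarrow> complex" where
  "zchar p m = cis (2 * pi * of_int m / of_nat p)"

lemma zchar_add: "zchar p (a + b) = zchar p a * zchar p b"
  by (simp add: zchar_def cis_mult algebra_simps add_divide_distrib)

lemma zchar_0 [simp]: "zchar p 0 = 1" by (simp add: zchar_def)

lemma cnj_zchar: "cnj (zchar p a) = zchar p (- a)" by (simp add: zchar_def cis_cnj)

lemma norm_zchar [simp]: "cmod (zchar p a) = 1" by (simp add: zchar_def)

lemma zchar_eq_1: "int p dvd a \<Longrightarrow> zchar p a = 1"
proof -
  assume "int p dvd a"
  then obtain k where k: "a = int p * k" by auto
  show ?thesis
  proof (cases "p = 0")
    case False
    have "2 * pi * of_int a / of_nat p = 2 * pi * of_int k" unfolding k using False by simp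
    then have "zchar p a = cis (2 * pi * of_int k)" unfolding zchar_def by (rule arg_cong)
    also have "\<dots> = 1" by (rule cis_multiple_2pi) simp
    finally show ?thesis .
  qed (use k in simp)
qed

lemma zchar_cong: "a mod int p = b mod int p \<Longrightarrow> zchar p a = zchar p b"
proof -
  assume "a mod int p = b mod int p"
  then have "int p dvd a - b" by (simp add: mod_eq_dvd_iff)
  then show ?thesis using zchar_add[of p "a - b" b] by (simp add: zchar_eq_1)
qed

lemma zchar_neq_1: "0 < p \<Longrightarrow> \<not> int p dvd a \<Longrightarrow> zchar p a \<noteq> 1"
proof
  assume p: "0 < p" and nd: "\<not> int p dvd a" and "zchar p a = 1"
  then have "cos (2 * pi * of_int a / of_nat p) = 1" by (simp add: zchar_def complex_eq_iff)
  then obtain k where "2 * pi * of_int a / of_nat p = of_int k * 2 * pi"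
    using cos_one_2pi_int by auto
  then have "real_of_int a = of_int (k * int p)" using p by (simp add: field_simps)
  then have "a = k * int p" by linarith
  with nd show False by simp
qed

lemma zchar_power: "zchar p (int z * a) = zchar p a ^ z"
  by (induction z) (simp_all add: distrib_right zchar_add)

text \<open>A geometric series whose ratio is 1 or a nontrivial \<open>p\<close>-th root of unity.
  It is the device that detects congruences modulo \<open>p\<close>.\<close>

lemma sum_zchar: 
  assumes p: "0 < p"
  shows "(\<Sum>z<p. zchar p (int z * a)) = (if int p dvd a then of_nat p else 0)"
proof (cases "int p dvd a")
  case True
  then show ?thesis by (simp add: zchar_eq_1)
next
  case False
  have "(\<Sum>z<p. zchar p (int z * a)) = (\<Sum>z<p. zchar p a ^ z)" by (simp add: zchar_power)
  also have "\<dots> = (1 - zchar p a ^ p) / (1 - zchar p a)"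
    using zchar_neq_1[OF p False] by (simp add: sum_gp_strict)
  also have "zchar p a ^ p = 1" by (simp flip: zchar_power add: zchar_eq_1)
  finally show ?thesis using False by simp
qed

lemma sum_zvec_zchar:
  assumes p: "0 < p" and "finite J"
  shows "(\<Sum>r\<in>zvec p J. zchar p (\<Sum>j\<in>J. int (r j) * u j)) = (if \<forall>j\<in>J. int p dvd u j then of_nat p ^ card J else 0)"
  using assms(2)
proof (induction J rule: finite_induct)
  case empty
  then show ?case by (simp add: zvec_empty p)
next
  case (insert i J)
  have c: "(\<Sum>j\<in>J. int (if j = i then z else r j) * u j) = (\<Sum>j\<in>J. int (r j) * u j)" for r z
    using insert.hyps by (intro sum.cong) auto
  have "(\<Sum>r\<in>zvec p (insert i J). zchar p (\<Sum>j\<in>insert i J. int (r j) * u j)) =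
    (\<Sum>r\<in>zvec p J. \<Sum>z<p. zchar p (int z * u i) * zchar p (\<Sum>j\<in>J. int (r j) * u j))"
    using insert.hyps by (simp add: sum_zvec_insert zchar_add c)
  also have "\<dots> = (\<Sum>r\<in>zvec p J. zchar p (\<Sum>j\<in>J. int (r j) * u j)) * (\<Sum>z<p. zchar p (int z * u i))"
    by (simp only: sum_distrib_right sum_distrib_left mult.commute)
  finally show ?case using insert by (simp add: sum_zchar[OF p])
qed

lemma zvec_eqI:
  assumes "u \<in> zvec p J" "v \<in> zvec p J" "\<And>j. j \<in> J \<Longrightarrow> int p dvd int (u j) - int (v j)"
  shows "u = v"
proof
  fix j
  show "u j = v j"
  proof (cases "j \<in> J")
    case True
    then have "int (u j) mod int p = int (v j) mod int p"
      using assms(3) by (simp add: mod_eq_dvd_iff)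
    then show ?thesis using assms(1,2) by (simp add: zvec_def)
  qed (use assms in \<open>simp add: zvec_def\<close>)
qed

definition zdot :: "nat set \<Rightarrow> (nat \<Rightarrow> nat) \<Rightarrow> (nat \<Rightarrow> nat) \<Rightarrow> int" where
  "zdot J r u = (\<Sum>j\<in>J. int (r j) * int (u j))"

text \<open>After expanding the square, orthogonality of characters in \<open>r\<close> kills every
  pair of distinct \<open>u\<close>, \<open>v\<close>. Each diagonal pair contributes
  \<open>p ^ card J\<close> because the characters are not normalised.\<close>

lemma parseval:
  assumes p: "0 < p" and J: "finite J"
  shows "(\<Sum>r\<in>zvec p J. (cmod (\<Sum>u\<in>zvec p J. F u * zchar p (- zdot J r u)))\<^sup>2) =
    real p ^ card J * (\<Sum>u\<in>zvec p J. (cmod (F u))\<^sup>2)"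
proof -
  let ?Z = "zvec p J"
  have fZ: "finite ?Z" by (rule finite_zvec[OF J p])
  have "complex_of_real (\<Sum>r\<in>?Z. (cmod (\<Sum>u\<in>?Z. F u * zchar p (- zdot J r u)))\<^sup>2) =
    (\<Sum>r\<in>?Z. \<Sum>u\<in>?Z. \<Sum>v\<in>?Z. F u * cnj (F v) * zchar p (\<Sum>j\<in>J. int (r j) * (int (v j) - int (u j))))"
    unfolding of_real_sum complex_norm_square cnj_sum sum_product
  proof (intro sum.cong refl)
    fix r u v
    have "(\<Sum>j\<in>J. int (r j) * (int (v j) - int (u j))) = - zdot J r u + zdot J r v"
      unfolding zdot_def by (simp add: right_diff_distrib sum_subtractf)
    then show "F u * zchar p (- zdot J r u) * cnj (F v * zchar p (- zdot J r v)) =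
      F u * cnj (F v) * zchar p (\<Sum>j\<in>J. int (r j) * (int (v j) - int (u j)))"
      by (simp only: zchar_add complex_cnj_mult cnj_zchar minus_minus mult_ac)
  qed
  also have "\<dots> = (\<Sum>u\<in>?Z. \<Sum>r\<in>?Z. \<Sum>v\<in>?Z. F u * cnj (F v) * zchar p (\<Sum>j\<in>J. int (r j) * (int (v j) - int (u j))))"
    by (rule sum.swap)
  also have "\<dots> = (\<Sum>u\<in>?Z. \<Sum>v\<in>?Z. \<Sum>r\<in>?Z. F u * cnj (F v) * zchar p (\<Sum>j\<in>J. int (r j) * (int (v j) - int (u j))))"
    by (intro sum.cong refl sum.swap)
  also have "\<dots> = (\<Sum>u\<in>?Z. \<Sum>v\<in>?Z. if u = v then F u * cnj (F v) * of_nat p ^ card J else 0)"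
  proof (intro sum.cong refl)
    fix u v assume "u \<in> ?Z" "v \<in> ?Z"
    then have "(\<forall>j\<in>J. int p dvd int (v j) - int (u j)) \<longleftrightarrow> u = v"
      using zvec_eqI[of v p J u] by auto
    then show "(\<Sum>r\<in>?Z. F u * cnj (F v) * zchar p (\<Sum>j\<in>J. int (r j) * (int (v j) - int (u j)))) =
       (if u = v then F u * cnj (F v) * of_nat p ^ card J else 0)"
      unfolding sum_distrib_left[symmetric] sum_zvec_zchar[OF p J] by simp
  qed
  also have "\<dots> = (\<Sum>u\<in>?Z. F u * cnj (F u) * of_nat p ^ card J)"
    using fZ by simp
  also have "\<dots> = complex_of_real (real p ^ card J * (\<Sum>u\<in>?Z. (cmod (F u))\<^sup>2))"
    unfolding of_real_mult of_real_sum complex_norm_square by (simp add: sum_distrib_left mult_ac)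
  finally show ?thesis by (simp only: of_real_eq_iff)
qed

lemma add_mod_cancel: "(a + c) mod p = (b + c) mod p \<Longrightarrow> a < p \<Longrightarrow> b < p \<Longrightarrow> a = (b::nat)"
proof -
  assume "(a + c) mod p = (b + c) mod p" and lt: "a < p" "b < p"
  then have "(int a + int c) mod int p = (int b + int c) mod int p"
    by (metis of_nat_add of_nat_mod)
  then have "int a mod int p = int b mod int p" by (simp add: mod_eq_dvd_iff)
  with lt show "a = b" by simp
qed

lemma sum_shift_mod:
  fixes p m :: nat
  assumes "0 < p"
  shows "(\<Sum>w<p. F ((w + m) mod p)) = (\<Sum>w<p. F w)"
proof -
  have inj: "inj_on (\<lambda>w. (w + m) mod p) {..<p}"
  proof (rule inj_onI)
    fix x y assume "x \<in> {..<p}" "y \<in> {..<p}" "(x + m) mod p = (y + m) mod p"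
    then show "x = y" by (auto intro: add_mod_cancel)
  qed
  have "(\<lambda>w. (w + m) mod p) ` {..<p} = {..<p}"
    by (rule card_subset_eq) (use assms in \<open>auto simp: card_image[OF inj]\<close>)
  with inj have "bij_betw (\<lambda>w. (w + m) mod p) {..<p} {..<p}" by (simp add: bij_betw_def)
  then show ?thesis by (rule sum.reindex_bij_betw)
qed

text \<open>Cauchy-Schwarz against a vector with unimodular entries, whose squared norm is
  \<open>card A\<close>.\<close>

lemma norm_sum_square_le:
  fixes x :: "'a \<Rightarrow> complex"
  assumes "\<And>w. w \<in> A \<Longrightarrow> cmod (c w) = 1"
  shows "(cmod (\<Sum>w\<in>A. c w * x w))\<^sup>2 \<le> real (card A) * (\<Sum>w\<in>A. (cmod (x w))\<^sup>2)"
proof -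
  have "cmod (\<Sum>w\<in>A. c w * x w) \<le> (\<Sum>w\<in>A. cmod (x w))"
    using assms by (intro order_trans[OF norm_sum] sum_mono) (simp add: norm_mult)
  then have "(cmod (\<Sum>w\<in>A. c w * x w))\<^sup>2 \<le> (\<Sum>w\<in>A. cmod (x w))\<^sup>2"
    by (rule power_mono) simp
  also have "\<dots> \<le> real (card A) * (\<Sum>w\<in>A. (cmod (x w))\<^sup>2)"
    using sum_squared_le_sum_of_squares[of "\<lambda>w. cmod (x w)" A] by (simp add: mult.commute)
  finally show ?thesis .
qed

section \<open>The Heisenberg group in coordinates and its action\<close>

definition heis_mat :: "nat \<Rightarrow> (nat \<Rightarrow> nat) \<Rightarrow> (nat \<Rightarrow> nat) \<Rightarrow> nat \<Rightarrow> nat \<Rightarrow> nat" where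
  "heis_mat n r y = (\<lambda>i j. if i = j \<and> i < n + 2 then 1 else if i = 0 \<and> j \<in> {1..n+1} then r j
     else if j = n + 1 \<and> i \<in> {1..n} then y i else 0)"

text \<open>The corner entry \<open>z\<close> is counted with the first row, so \<open>r\<close> has
  \<open>n + 1\<close> free entries and \<open>y\<close> only \<open>n\<close>. This makes the
  action on coordinate 0 depend on \<open>r\<close> alone and on the other coordinates on
  \<open>y\<close> alone. The bound \<open>2 \<le> p\<close> ensures that the diagonal entry 1 is a
  reduced residue.\<close>

lemma bij_heis_mat:
  assumes p: "2 \<le> p"
  shows "bij_betw (\<lambda>(r, y). heis_mat n r y) (zvec p {1..n+1} \<times> zvec p {1..n}) (heis p n)"
proof (rule bij_betw_byWitness[where f' = "\<lambda>M. (\<lambda>j. if j \<in> {1..n+1} then M 0 j else 0, \<lambda>i. if i \<in> {1..n} then M i (n+1) else 0)"])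
  show "\<forall>a\<in>zvec p {1..n+1} \<times> zvec p {1..n}. (\<lambda>M. (\<lambda>j. if j \<in> {1..n+1} then M 0 j else 0, \<lambda>i. if i \<in> {1..n} then M i (n+1) else 0)) ((\<lambda>(r, y). heis_mat n r y) a) = a"
    by (auto simp: zvec_def heis_mat_def fun_eq_iff)
  show "\<forall>M\<in>heis p n. (\<lambda>(r, y). heis_mat n r y) ((\<lambda>M. (\<lambda>j. if j \<in> {1..n+1} then M 0 j else 0, \<lambda>i. if i \<in> {1..n} then M i (n+1) else 0)) M) = M"
  proof
    fix M assume M: "M \<in> heis p n"
    have "heis_mat n (\<lambda>j. if j \<in> {1..n+1} then M 0 j else 0) (\<lambda>i. if i \<in> {1..n} then M i (n+1) else 0) i j = M i j" for i j
    proof (cases "i < n + 2 \<and> j < n + 2")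
      case True
      then have "i = 0 \<or> i \<in> {1..n} \<or> i = n + 1" "j = 0 \<or> j \<in> {1..n} \<or> j = n + 1" by auto
      then show ?thesis
        using M True unfolding heis_def heis_mat_def by auto
    next
      case False
      then show ?thesis using M unfolding heis_def heis_mat_def by auto
    qed
    then show "(\<lambda>(r, y). heis_mat n r y) ((\<lambda>M. (\<lambda>j. if j \<in> {1..n+1} then M 0 j else 0, \<lambda>i. if i \<in> {1..n} then M i (n+1) else 0)) M) = M"
      by (simp add: fun_eq_iff)
  qed
  show "(\<lambda>(r, y). heis_mat n r y) ` (zvec p {1..n+1} \<times> zvec p {1..n}) \<subseteq> heis p n"
    using p by (auto simp: zvec_def heis_mat_def heis_def)
  show "(\<lambda>M. (\<lambda>j. if j \<in> {1..n+1} then M 0 j else 0, \<lambda>i. if i \<in> {1..n} then M i (n+1) else 0)) ` heis p n \<subseteq> zvec p {1..n+1} \<times> zvec p {1..n}"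
    using p by (auto simp: zvec_def heis_def)
qed

lemma heisE:
  assumes "2 \<le> p" "a \<in> heis p n"
  obtains r y where "r \<in> zvec p {1..n+1}" "y \<in> zvec p {1..n}" "a = heis_mat n r y"
proof -
  have "a \<in> (\<lambda>(r, y). heis_mat n r y) ` (zvec p {1..n+1} \<times> zvec p {1..n})"
    using bij_heis_mat[OF assms(1), of n] assms(2) unfolding bij_betw_def by blast
  then obtain x where x: "x \<in> zvec p {1..n+1} \<times> zvec p {1..n}" "a = (\<lambda>(r, y). heis_mat n r y) x"
    by blast
  show ?thesis by (rule that[of "fst x" "snd x"]) (use x in auto)
qed

lemma heis_mat_in_heis: "2 \<le> p \<Longrightarrow> r \<in> zvec p {1..n+1} \<Longrightarrow> y \<in> zvec p {1..n} \<Longrightarrow> heis_mat n r y \<in> heis p n"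
  using bij_heis_mat[of p n] unfolding bij_betw_def by auto

lemma sum_heis:
  assumes "2 \<le> p"
  shows "(\<Sum>a\<in>heis p n. F a) = (\<Sum>r\<in>zvec p {1..n+1}. \<Sum>y\<in>zvec p {1..n}. F (heis_mat n r y))"
  unfolding sum.cartesian_product
  by (subst sum.reindex_bij_betw[OF bij_heis_mat[OF assms], symmetric]) (simp add: case_prod_unfold)

lemma finite_heis: "2 \<le> p \<Longrightarrow> finite (heis p n)"
  using bij_betw_finite[OF bij_heis_mat[of p n]] by (simp add: finite_zvec)

lemma card_heis: "2 \<le> p \<Longrightarrow> card (heis p n) = p ^ (2 * n + 1)"
  using bij_betw_same_card[OF bij_heis_mat[of p n]]
  by (simp add: card_cartesian_product card_zvec power_add mult_2)

lemma vecs_zvec: "vecs p n = zvec p (insert 0 {1..n+1})"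
  by (auto simp: vecs_def zvec_def)

lemma sum_vecs: "(\<Sum>v\<in>vecs p n. F v) = (\<Sum>u\<in>zvec p {1..n+1}. \<Sum>z<p. F (u(0 := z)))"
  unfolding vecs_zvec by (rule sum_zvec_insert) simp

lemma act_heis_mat:
  assumes v: "v \<in> vecs p n"
  shows "act p n (heis_mat n r y) v = (\<lambda>i. if i = 0 then (v 0 + (\<Sum>j=1..n+1. r j * v j)) mod p
     else if i \<in> {1..n} then (v i + y i * v (n + 1)) mod p else v i)"
proof
  fix i
  have S: "{..<n+2} = insert 0 {1..n+1}" by auto
  have vp: "v i < p" for i using v by (simp add: vecs_def)
  consider "i = 0" | "i \<in> {1..n}" | "i = n + 1" | "n + 1 < i" by force
  then show "act p n (heis_mat n r y) v i = (if i = 0 then (v 0 + (\<Sum>j=1..n+1. r j * v j)) mod p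
     else if i \<in> {1..n} then (v i + y i * v (n + 1)) mod p else v i)"
  proof cases
    case 1
    have "(\<Sum>j<n+2. heis_mat n r y 0 j * v j) = v 0 + (\<Sum>j=1..n+1. heis_mat n r y 0 j * v j)"
      unfolding S by (simp add: heis_mat_def)
    also have "(\<Sum>j=1..n+1. heis_mat n r y 0 j * v j) = (\<Sum>j=1..n+1. r j * v j)"
      by (intro sum.cong) (auto simp: heis_mat_def)
    finally show ?thesis using 1 by (simp add: act_def)
  next
    case 2
    have "(\<Sum>j<n+2. heis_mat n r y i j * v j) = (\<Sum>j<n+2. (if j = i then v i else 0) + (if j = n+1 then y i * v (n+1) else 0))"
      using 2 by (intro sum.cong) (auto simp: heis_mat_def)
    also have "\<dots> = v i + y i * v (n+1)" using 2 by (subst sum.distrib) auto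
    finally show ?thesis using 2 by (simp add: act_def)
  next
    case 3
    have "(\<Sum>j<n+2. heis_mat n r y i j * v j) = (\<Sum>j<n+2. (if j = i then v i else 0))"
      using 3 by (intro sum.cong) (auto simp: heis_mat_def)
    then show ?thesis using 3 vp by (simp add: act_def)
  next
    case 4
    then show ?thesis using v by (simp add: act_def vecs_def)
  qed
qed

lemma act_in_vecs:
  assumes "v \<in> vecs p n"
  shows "act p n (heis_mat n r y) v \<in> vecs p n"
proof -
  have "0 < p" using assms unfolding vecs_def by (metis (mono_tags, lifting) less_zeroE mem_Collect_eq neq0_conv)
  then show ?thesis using assms unfolding act_heis_mat[OF assms] by (auto simp: vecs_def)
qed

lemma finite_vecs: "0 < p \<Longrightarrow> finite (vecs p n)"
  unfolding vecs_zvec by (rule finite_zvec) auto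

text \<open>The matrix is triangular: the last coordinate is fixed, it determines the shifts of the
  middle ones, and all of these determine the shift of coordinate 0. Injectivity on a finite set
  gives the rest.\<close>

lemma act_bij:
  assumes p: "2 \<le> p" and a: "a \<in> heis p n"
  shows "bij_betw (act p n a) (vecs p n) (vecs p n)"
proof -
  obtain r y where a: "a = heis_mat n r y" using heisE[OF assms] by metis
  have inj: "inj_on (act p n a) (vecs p n)"
  proof (rule inj_onI)
    fix v w assume v: "v \<in> vecs p n" and w: "w \<in> vecs p n" and eq: "act p n a v = act p n a w"
    have eq: "(if i = 0 then (v 0 + (\<Sum>j=1..n+1. r j * v j)) mod p
     else if i \<in> {1..n} then (v i + y i * v (n + 1)) mod p else v i) = 
       (if i = 0 then (w 0 + (\<Sum>j=1..n+1. r j * w j)) mod p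
     else if i \<in> {1..n} then (w i + y i * w (n + 1)) mod p else w i)" for i
      using eq unfolding a act_heis_mat[OF v] act_heis_mat[OF w] by (rule fun_cong)
    have lt: "v i < p" "w i < p" for i using v w by (auto simp: vecs_def)
    have 1: "v (n+1) = w (n+1)" using eq[of "n+1"] by simp
    have 2: "v i = w i" if "i \<noteq> 0" for i
    proof (cases "i \<in> {1..n}")
      case True
      then show ?thesis using eq[of i] 1 lt by (auto intro: add_mod_cancel)
    next
      case False
      then show ?thesis using eq[of i] that by simp
    qed
    have "(\<Sum>j=1..n+1. r j * v j) = (\<Sum>j=1..n+1. r j * w j)" using 2 by (intro sum.cong) auto
    then have "v 0 = w 0" using eq[of 0] lt by (auto intro: add_mod_cancel)
    with 2 have "v i = w i" for i by (cases "i = 0") auto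
    then show "v = w" by (rule ext)
  qed
  moreover have "act p n a ` vecs p n = vecs p n"
    using inj act_in_vecs finite_vecs[of p n] p unfolding a
    by (intro card_subset_eq) (auto simp: card_image)
  ultimately show ?thesis by (simp add: bij_betw_def)
qed

section \<open>The oracle as a permutation unitary\<close>

lemma qoracle_perm: "qoracle p n a = perm_mat (\<lambda>(v, k). (act p n a v, k))"
  by (auto simp: fun_eq_iff qoracle_def perm_mat_def)

lemma bij_oracle:
  assumes "2 \<le> p" "a \<in> heis p n"
  shows "bij_betw (\<lambda>(v, k). (act p n a v, k)) (idxset p n N) (idxset p n N)"
  using act_bij[OF assms] unfolding bij_betw_def idxset_def
  by (force simp: inj_on_def image_iff)

lemma finite_idxset: "0 < p \<Longrightarrow> finite (idxset p n N)"
  unfolding idxset_def by (simp add: finite_vecs)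

lemma qoracle_unitary:
  assumes "2 \<le> p" "a \<in> heis p n"
  shows "unitary_on (idxset p n N) (qoracle p n a)"
  unfolding qoracle_perm using assms by (intro perm_mat_unitary bij_oracle finite_idxset) auto

lemma run_norm:
  assumes p: "2 \<le> p" and a: "a \<in> heis p n" and alg: "is_query_alg p n t N \<psi> U E"
  shows "k \<le> t \<Longrightarrow> (\<Sum>i\<in>idxset p n N. (cmod (run p n N \<psi> U a k i))\<^sup>2) = 1"
proof (induction k)
  case 0
  then show ?case using alg by (simp add: is_query_alg_def)
next
  case (Suc k)
  have "unitary_on (idxset p n N) (U k)" using alg Suc.prems by (simp add: is_query_alg_def)
  then show ?case
    using Suc p by (simp add: unitary_norm finite_idxset qoracle_unitary[OF p a])
qed

section \<open>Upper bound for a single query\<close>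

text \<open>
  Indices of the spanning functions: \<open>(u, Some q)\<close> stands for \<open>\<omega>\<^bsup>r \<cdot> u\<^esup> [y = q]\<close> and \<open>(u, None)\<close>
  for \<open>\<omega>\<^bsup>r \<cdot> u\<^esup>\<close>. In the second family \<open>u = 0\<close> is left out, since the constant is
  already the sum of the functions \<open>[y = q]\<close>.
\<close>

definition freqs :: "nat \<Rightarrow> nat \<Rightarrow> ((nat \<Rightarrow> nat) \<times> (nat \<Rightarrow> nat) option) set" where
  "freqs p n = {u \<in> zvec p {1..n+1}. u (n + 1) \<noteq> 0 \<or> u = (\<lambda>_. 0)} \<times> Some ` zvec p {1..n}
     \<union> (zvec p {1..n} - {\<lambda>_. 0}) \<times> {None}"

definition freq_fun :: "nat \<Rightarrow> nat \<Rightarrow> (nat \<Rightarrow> nat) \<times> (nat \<Rightarrow> nat) option \<Rightarrow> (nat \<Rightarrow> nat) \<Rightarrow> (nat \<Rightarrow> nat) \<Rightarrow> complex" where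
  "freq_fun p n t r y = (case snd t of None \<Rightarrow> 1 | Some q \<Rightarrow> if y = q then 1 else 0) * zchar p (zdot {1..n+1} r (fst t))"

definition span_dim :: "nat \<Rightarrow> nat \<Rightarrow> nat" where
  "span_dim p n = (p ^ (n + 1) - p ^ n + 1) * p ^ n + (p ^ n - 1)"

lemma zvec_remove: "j \<notin> J \<Longrightarrow> zvec p J = {u \<in> zvec p (insert j J). u j = 0}"
  by (auto simp: zvec_def) metis

lemma zvec_last: "zvec p {1..n} = {u \<in> zvec p {1..n+1}. u (n + 1) = 0}"
proof -
  have 1: "{1..n+1} = insert (n + 1) {1..n}" by auto
  show ?thesis unfolding 1 by (rule zvec_remove) simp
qed

lemma finite_freqs: "0 < p \<Longrightarrow> finite (freqs p n)"
  unfolding freqs_def by (simp add: finite_zvec)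

lemma card_zero_or_last:
  assumes p: "0 < p"
  shows "card {u \<in> zvec p {1..n+1}. u (n + 1) \<noteq> 0 \<or> u = (\<lambda>_. 0)} = p ^ (n + 1) - p ^ n + 1"
proof -
  have "{u \<in> zvec p {1..n+1}. u (n + 1) \<noteq> 0 \<or> u = (\<lambda>_. 0)} = insert (\<lambda>_. 0) (zvec p {1..n+1} - zvec p {1..n})"
    using zero_in_zvec[OF p] unfolding zvec_last[of p n] by auto
  moreover have "card (insert (\<lambda>_. 0) (zvec p {1..n+1} - zvec p {1..n})) = p ^ (n + 1) - p ^ n + 1"
    using p zero_in_zvec[OF p, of "{1..n}"]
    by (subst card_insert_disjoint) (auto simp: finite_zvec card_zvec card_Diff_subset zvec_mono)
  ultimately show ?thesis by simp
qed

lemma card_freqs: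
  assumes p: "0 < p"
  shows "card (freqs p n) = span_dim p n"
proof -
  note c = card_zero_or_last[OF p, of n]
  have 1: "card ({u \<in> zvec p {1..n+1}. u (n + 1) \<noteq> 0 \<or> u = (\<lambda>_. 0)} \<times> Some ` zvec p {1..n}) = (p ^ (n + 1) - p ^ n + 1) * p ^ n"
    unfolding card_cartesian_product c using p by (simp add: card_image card_zvec)
  have 2: "card ((zvec p {1..n} - {\<lambda>_. 0}) \<times> {None :: (nat \<Rightarrow> nat) option}) = p ^ n - 1"
    unfolding card_cartesian_product using p by (simp add: card_zvec card_Diff_singleton zero_in_zvec)
  show ?thesis unfolding freqs_def span_dim_def 1[symmetric] 2[symmetric]
    using p by (intro card_Un_disjoint) (auto simp: finite_zvec)
qed

lemma span_dim_eq:
  assumes p: "0 < p"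
  shows "real (span_dim p n) / real (p ^ (2 * n + 1)) = 1 - 1 / real p + 2 / real p ^ (n + 1) - 1 / real p ^ (2 * n + 1)"
proof -
  have le: "p ^ n \<le> p ^ (n + 1)" "1 \<le> p ^ n" using p by auto
  have "real (span_dim p n) = (real p ^ (n + 1) - real p ^ n + 1) * real p ^ n + (real p ^ n - 1)"
    unfolding span_dim_def of_nat_add of_nat_mult of_nat_diff[OF le(1)] of_nat_diff[OF le(2)] by simp
  moreover have "real p ^ (2 * n + 1) = real p ^ n * real p ^ n * real p" "real p ^ (n + 1) = real p ^ n * real p"
    by (simp_all add: power_add mult_2)
  \<comment> \<open>With \<open>x\<close> for \<open>p ^ n\<close> and \<open>q\<close> for
    \<open>p\<close>, the claim is an identity of rational functions.\<close>
  moreover have key: "((x * q - x + 1) * x + (x - 1)) / (x * x * q) = 1 - 1 / q + 2 / (x * q) - 1 / (x * x * q)"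
    if "x > 0" "q > 0" for x q :: real
    using that by (simp add: field_simps)
  moreover note key[of "real p ^ n" "real p"]
  ultimately show ?thesis using p by (simp add: mult_ac)
qed

section \<open>The linear span of the frequency functions\<close>

definition spanned :: "nat \<Rightarrow> nat \<Rightarrow> ((nat \<Rightarrow> nat) \<Rightarrow> (nat \<Rightarrow> nat) \<Rightarrow> complex) \<Rightarrow> bool" where
  "spanned p n F \<longleftrightarrow> (\<exists>c. \<forall>r\<in>zvec p {1..n+1}. \<forall>y\<in>zvec p {1..n}. F r y = (\<Sum>t\<in>freqs p n. freq_fun p n t r y * c t))"

lemma spanned_sum:
  assumes "\<And>m. m \<in> M \<Longrightarrow> spanned p n (F m)"
  shows "spanned p n (\<lambda>r y. \<Sum>m\<in>M. d m * F m r y)"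
proof -
  have "\<forall>m\<in>M. \<exists>c. \<forall>r\<in>zvec p {1..n+1}. \<forall>y\<in>zvec p {1..n}. F m r y = (\<Sum>t\<in>freqs p n. freq_fun p n t r y * c t)"
    using assms by (simp only: spanned_def) blast
  from bchoice[OF this] obtain c where c:
    "\<And>m r y. m \<in> M \<Longrightarrow> r \<in> zvec p {1..n+1} \<Longrightarrow> y \<in> zvec p {1..n} \<Longrightarrow> F m r y = (\<Sum>t\<in>freqs p n. freq_fun p n t r y * c m t)"
    by blast
  have "(\<Sum>m\<in>M. d m * F m r y) = (\<Sum>t\<in>freqs p n. freq_fun p n t r y * (\<Sum>m\<in>M. d m * c m t))"
    if "r \<in> zvec p {1..n+1}" "y \<in> zvec p {1..n}" for r y
  proof -
    have "(\<Sum>m\<in>M. d m * F m r y) = (\<Sum>m\<in>M. \<Sum>t\<in>freqs p n. freq_fun p n t r y * (d m * c m t))"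
      using c[OF _ that] by (simp add: sum_distrib_left mult_ac)
    then show ?thesis by (subst (asm) sum.swap) (simp add: sum_distrib_left)
  qed
  then show ?thesis unfolding spanned_def
    by (intro exI[of _ "\<lambda>t. \<Sum>m\<in>M. d m * c m t"] ballI)
qed

text \<open>An arbitrary function of \<open>y\<close> is a combination of the indicators
  \<open>[y = q]\<close>, so the coefficient at \<open>(u, Some q)\<close> is
  \<open>g q\<close>.\<close>

lemma spanned_some:
  assumes p: "0 < p" and u: "u \<in> zvec p {1..n+1}" and u0: "u (n + 1) \<noteq> 0 \<or> u = (\<lambda>_. 0)"
  shows "spanned p n (\<lambda>r y. zchar p (zdot {1..n+1} r u) * g y)"
  unfolding spanned_def
proof (intro exI ballI)
  fix r y assume y: "y \<in> zvec p {1..n}"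
  have "(\<Sum>t\<in>freqs p n. freq_fun p n t r y * (if fst t = u \<and> snd t \<noteq> None then g (the (snd t)) else 0)) =
    (\<Sum>t\<in>freqs p n. if t = (u, Some y) then zchar p (zdot {1..n+1} r u) * g y else 0)"
    by (intro sum.cong refl) (auto simp: freq_fun_def split: option.splits)
  also have "\<dots> = zchar p (zdot {1..n+1} r u) * g y"
    using u u0 y finite_freqs[OF p, of n] by (simp add: freqs_def)
  finally show "zchar p (zdot {1..n+1} r u) * g y =
    (\<Sum>t\<in>freqs p n. freq_fun p n t r y * (if fst t = u \<and> snd t \<noteq> None then g (the (snd t)) else 0))" ..
qed

text \<open>The index \<open>(u, None)\<close> exists only for nonzero \<open>u\<close>; at
  \<open>u = 0\<close> the constant is taken from the first family instead.\<close>

lemma spanned_none: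
  assumes p: "0 < p" and u: "u \<in> zvec p {1..n}"
  shows "spanned p n (\<lambda>r y. zchar p (zdot {1..n+1} r u) * c)"
proof (cases "u = (\<lambda>_. 0)")
  case True
  then show ?thesis using spanned_some[OF p zero_in_zvec[OF p], of n "\<lambda>_. c"] by simp
next
  case False
  have "zchar p (zdot {1..n+1} r u) * c = (\<Sum>t\<in>freqs p n. freq_fun p n t r y * (if t = (u, None) then c else 0))" for r y
  proof -
    have "(\<Sum>t\<in>freqs p n. freq_fun p n t r y * (if t = (u, None) then c else 0)) = 
      (\<Sum>t\<in>freqs p n. if t = (u, None) then zchar p (zdot {1..n+1} r u) * c else 0)"
      by (intro sum.cong refl) (auto simp: freq_fun_def)
    then show ?thesis
      using u False finite_freqs[OF p, of n] by (simp add: freqs_def)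
  qed
  then show ?thesis unfolding spanned_def
    by (intro exI[of _ "\<lambda>t. if t = (u, None) then c else 0"] ballI)
qed

text \<open>Separates the variables: the condition at coordinate 0 involves only \<open>r\<close>
  and has the divisibility form that \<open>sum_zchar\<close> detects, while the remaining
  conditions involve only \<open>y\<close>.\<close>

lemma act_eq_iff:
  assumes v: "v \<in> vecs p n" and w: "w \<in> vecs p n"
  shows "w = act p n (heis_mat n r y) v \<longleftrightarrow> int p dvd int (v 0) + zdot {1..n+1} r v - int (w 0) \<and>
    (\<forall>i\<in>{1..n}. w i = (v i + y i * v (n + 1)) mod p) \<and> w (n + 1) = v (n + 1)"
proof -
  have w0: "w 0 < p" using w by (simp add: vecs_def)
  have "w 0 = (v 0 + (\<Sum>j=1..n+1. r j * v j)) mod p \<longleftrightarrow> 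
     int (v 0 + (\<Sum>j=1..n+1. r j * v j)) mod int p = int (w 0) mod int p"
    unfolding of_nat_mod[symmetric] of_nat_eq_iff using w0 by auto
  also have "\<dots> \<longleftrightarrow> int p dvd int (v 0) + zdot {1..n+1} r v - int (w 0)"
    by (simp add: mod_eq_dvd_iff zdot_def)
  finally have 1: "w 0 = (v 0 + (\<Sum>j=1..n+1. r j * v j)) mod p \<longleftrightarrow> int p dvd int (v 0) + zdot {1..n+1} r v - int (w 0)" .
  have "w = act p n (heis_mat n r y) v \<longleftrightarrow> w 0 = (v 0 + (\<Sum>j=1..n+1. r j * v j)) mod p \<and>
    (\<forall>i\<in>{1..n}. w i = (v i + y i * v (n + 1)) mod p) \<and> w (n + 1) = v (n + 1)" (is "?L \<longleftrightarrow> ?R")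
  proof
    assume ?L then show ?R by (simp add: act_heis_mat[OF v])
  next
    assume R: ?R
    show ?L
    proof
      fix i
      consider "i = 0" | "i \<in> {1..n}" | "i = n + 1" | "n + 2 \<le> i" by force
      then show "w i = act p n (heis_mat n r y) v i"
      proof cases
        case 4
        then show ?thesis unfolding act_heis_mat[OF v] using v w by (simp add: vecs_def)
      qed (use R in \<open>simp_all add: act_heis_mat[OF v]\<close>)
    qed
  qed
  then show ?thesis by (simp only: 1)
qed

text \<open>A multiple of \<open>v\<close> must be reduced modulo \<open>p\<close> to be an
  admissible frequency; the character does not notice the reduction.\<close>

lemma zdot_scale:
  "zchar p (zdot J r (\<lambda>i. if i \<in> J then (m * v i) mod p else 0)) = zchar p (int m * zdot J r v)"
proof (rule zchar_cong)
  have "zdot J r (\<lambda>i. if i \<in> J then (m * v i) mod p else 0) = (\<Sum>j\<in>J. int (r j) * (int m * int (v j) mod int p))"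
    unfolding zdot_def by (intro sum.cong) (auto simp: of_nat_mod)
  also have "\<dots> mod int p = (\<Sum>j\<in>J. int (r j) * (int m * int (v j) mod int p) mod int p) mod int p"
    by (rule mod_sum_eq[symmetric])
  also have "\<dots> = (\<Sum>j\<in>J. int (r j) * (int m * int (v j))) mod int p"
    by (simp only: mod_mult_right_eq mod_sum_eq)
  also have "(\<Sum>j\<in>J. int (r j) * (int m * int (v j))) = int m * zdot J r v"
    unfolding zdot_def by (simp add: sum_distrib_left mult_ac)
  finally show "zdot J r (\<lambda>i. if i \<in> J then (m * v i) mod p else 0) mod int p = int m * zdot J r v mod int p" .
qed

text \<open>The congruence at coordinate 0 is an average over \<open>m < p\<close> of characters in
  \<open>r\<close> with frequency \<open>m v\<close>, multiplied by the indicator \<open>g\<close>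
  of the conditions on \<open>y\<close>. If the last coordinate of \<open>v\<close> is 0, then
  \<open>g\<close> is constant and the frequency lies in the \<open>None\<close> family. Otherwise
  primality of \<open>p\<close> keeps the last coordinate of \<open>m v\<close> nonzero for
  \<open>m \<noteq> 0\<close>, and \<open>m = 0\<close> gives the zero frequency, so any
  \<open>g\<close> is allowed.\<close>

lemma spanned_act:
  assumes pr: "prime p" and v: "v \<in> vecs p n" and w: "w \<in> vecs p n"
  shows "spanned p n (\<lambda>r y. if w = act p n (heis_mat n r y) v then 1 else 0)"
proof -
  have p: "0 < p" using pr by (simp add: prime_gt_0_nat)
  define u where "u = (\<lambda>m i. if i \<in> {1..n+1} then (m * v i) mod p else 0)"
  define g where "g = (\<lambda>y. if (\<forall>i\<in>{1..n}. w i = (v i + y i * v (n + 1)) mod p) \<and> w (n + 1) = v (n + 1) then 1 else (0::complex))"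
  have uz: "u m \<in> zvec p {1..n+1}" for m using p by (simp add: u_def zvec_def)
  have "spanned p n (\<lambda>r y. zchar p (zdot {1..n+1} r (u m)) * g y)" if m: "m < p" for m
  proof (cases "v (n + 1) = 0")
    case True
    have g: "g y = g (\<lambda>_. 0)" for y unfolding g_def True by simp
    have "(\<lambda>r y. zchar p (zdot {1..n+1} r (u m)) * g y) = (\<lambda>r y. zchar p (zdot {1..n+1} r (u m)) * g (\<lambda>_. 0))"
      by (intro ext arg_cong2[of _ _ _ _ "(*)"] refl g)
    moreover have "u m \<in> zvec p {1..n}" using uz True unfolding zvec_last[of p n] by (simp add: u_def)
    ultimately show ?thesis by (simp only: spanned_none[OF p])
  next
    case False
    have "u m (n + 1) \<noteq> 0 \<or> u m = (\<lambda>_. 0)"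
    proof (cases "m = 0")
      case True
      then show ?thesis by (simp add: u_def fun_eq_iff)
    next
      case m0: False
      have "\<not> p dvd m" "\<not> p dvd v (n + 1)"
        using m m0 False v nat_dvd_not_less[of m p] nat_dvd_not_less[of "v (n + 1)" p] by (auto simp: vecs_def)
      then have "\<not> p dvd m * v (n + 1)" using pr by (simp add: prime_dvd_mult_iff)
      then show ?thesis by (simp add: u_def dvd_eq_mod_eq_0)
    qed
    then show ?thesis using spanned_some[OF p uz] by blast
  qed
  then have "spanned p n (\<lambda>r y. \<Sum>m<p. zchar p (int m * (int (v 0) - int (w 0))) / of_nat p * (zchar p (zdot {1..n+1} r (u m)) * g y))"
    by (intro spanned_sum) auto
  moreover have "(\<Sum>m<p. zchar p (int m * (int (v 0) - int (w 0))) / of_nat p * (zchar p (zdot {1..n+1} r (u m)) * g y)) =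
    (if w = act p n (heis_mat n r y) v then 1 else 0)" for r y
  proof -
    have "zchar p (int m * (int (v 0) - int (w 0))) * zchar p (zdot {1..n+1} r (u m)) = zchar p (int m * (int (v 0) + zdot {1..n+1} r v - int (w 0)))" for m
      unfolding u_def zdot_scale zchar_add[symmetric] by (simp add: algebra_simps)
    then have "(\<Sum>m<p. zchar p (int m * (int (v 0) - int (w 0))) / of_nat p * (zchar p (zdot {1..n+1} r (u m)) * g y)) =
      (\<Sum>m<p. zchar p (int m * (int (v 0) + zdot {1..n+1} r v - int (w 0)))) * g y / of_nat p"
      by (simp add: sum_distrib_right sum_divide_distrib mult.assoc[symmetric])
    then show ?thesis using p by (simp add: sum_zchar act_eq_iff[OF v w] g_def)
  qed
  ultimately show ?thesis by simp
qed

text \<open>The oracle is a combination of matrices \<open>K t\<close> independent of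
  \<open>a\<close>, with scalar coefficients \<open>h t a\<close>. By linearity every final state is
  the same combination of fixed vectors, one for each element of \<open>freqs\<close>, so
  \<open>discrimination_bound\<close> applies.\<close>

lemma single_query_upper_bound:
  assumes pr: "prime p" and alg: "is_query_alg p n 1 N \<psi> U E"
  shows "success_prob p n 1 N \<psi> U E \<le> real (span_dim p n) / real (p ^ (2 * n + 1))"
proof -
  have p: "2 \<le> p" using pr by (rule prime_ge_2_nat)
  then have p0: "0 < p" by simp
  let ?I = "idxset p n N"
  have "\<forall>x\<in>vecs p n \<times> vecs p n. \<exists>c. \<forall>r\<in>zvec p {1..n+1}. \<forall>y\<in>zvec p {1..n}.
     (if fst x = act p n (heis_mat n r y) (snd x) then 1 else 0) = (\<Sum>t\<in>freqs p n. freq_fun p n t r y * c t)"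
    using spanned_act[OF pr, of _ n, unfolded spanned_def] by (intro ballI) (simp only: mem_Times_iff)
  from bchoice[OF this] obtain c where c: "\<And>w v r y. w \<in> vecs p n \<Longrightarrow> v \<in> vecs p n \<Longrightarrow> r \<in> zvec p {1..n+1} \<Longrightarrow> y \<in> zvec p {1..n} \<Longrightarrow>
     (if w = act p n (heis_mat n r y) v then 1 else 0) = (\<Sum>t\<in>freqs p n. freq_fun p n t r y * c (w, v) t)"
    by force
  define K :: "(nat \<Rightarrow> nat) \<times> (nat \<Rightarrow> nat) option \<Rightarrow> cmat" where "K = (\<lambda>t i j. if snd i = snd j then c (fst i, fst j) t else 0)"
  \<comment> \<open>Transports \<open>freq_fun\<close> from pairs of coordinates to group elements
    by inverting the parametrisation.\<close>
  define h where "h = (\<lambda>t a. case inv_into (zvec p {1..n+1} \<times> zvec p {1..n}) (\<lambda>(r, y). heis_mat n r y) a of (r, y) \<Rightarrow> freq_fun p n t r y)"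
  have h: "h t (heis_mat n r y) = freq_fun p n t r y" if "r \<in> zvec p {1..n+1}" "y \<in> zvec p {1..n}" for t r y
    unfolding h_def using bij_betw_inv_into_left[OF bij_heis_mat[OF p], of "(r, y)" n] that by simp
  have K: "qoracle p n a i j = (\<Sum>t\<in>freqs p n. h t a * K t i j)"
    if a: "a \<in> heis p n" and ij: "i \<in> ?I" "j \<in> ?I" for a i j
  proof -
    obtain r y where ry: "r \<in> zvec p {1..n+1}" "y \<in> zvec p {1..n}" "a = heis_mat n r y"
      using heisE[OF p a] by metis
    have "(\<Sum>t\<in>freqs p n. h t a * K t i j) = (if snd i = snd j then if fst i = act p n a (fst j) then 1 else 0 else 0)"
      using c[OF _ _ ry(1,2), of "fst i" "fst j"] ij unfolding ry(3) h[OF ry(1,2)] K_def 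
      by (auto simp: idxset_def)
    then show ?thesis by (auto simp: qoracle_def case_prod_unfold)
  qed
  have "(\<Sum>a\<in>heis p n. Re (cinner ?I (run p n N \<psi> U a 1) (mat_app ?I (E a) (run p n N \<psi> U a 1)))) \<le> real (card (freqs p n))"
  proof (rule discrimination_bound)
    show "povm_on ?I (heis p n) E" using alg by (simp add: is_query_alg_def)
    show "finite ?I" by (rule finite_idxset[OF p0])
    show "finite (freqs p n)" by (rule finite_freqs[OF p0])
    show "(\<Sum>i\<in>?I. (cmod (run p n N \<psi> U a 1 i))\<^sup>2) = 1" if "a \<in> heis p n" for a
      by (rule run_norm[OF p that alg]) simp
    show "run p n N \<psi> U a 1 i = (\<Sum>t\<in>freqs p n. h t a * mat_app ?I (U 0) (mat_app ?I (K t) \<psi>) i)"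
      if a: "a \<in> heis p n" and i: "i \<in> ?I" for a i
    proof -
      have "mat_app ?I (qoracle p n a) \<psi> j = (\<Sum>t\<in>freqs p n. h t a * mat_app ?I (K t) \<psi> j)" if j: "j \<in> ?I" for j
      proof -
        have "mat_app ?I (qoracle p n a) \<psi> j = (\<Sum>l\<in>?I. \<Sum>t\<in>freqs p n. h t a * (K t j l * \<psi> l))"
          unfolding mat_app_def using K[OF a j] by (simp add: sum_distrib_right mult.assoc)
        then show ?thesis unfolding mat_app_def by (subst (asm) sum.swap) (simp add: sum_distrib_left)
      qed
      then have "run p n N \<psi> U a 1 i = (\<Sum>j\<in>?I. \<Sum>t\<in>freqs p n. h t a * (U 0 i j * mat_app ?I (K t) \<psi> j))"
        by (simp add: mat_app_def[of _ "U 0"] sum_distrib_left mult_ac)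
      then show ?thesis by (subst (asm) sum.swap) (simp add: mat_app_def[of _ "U 0"] sum_distrib_left)
    qed
  qed
  then show ?thesis
    unfolding success_prob_def card_heis[OF p] card_freqs[OF p0] using p0 by (simp add: field_simps)
qed

section \<open>Algorithms\<close>

text \<open>By adjointness a permutation passes from the state to the test vector, so a circuit of
  permutations is evaluated by composing index maps inside \<open>g\<close>.\<close>

lemma cinner_perm_shift:
  assumes "finite I" "bij_betw \<sigma> I I"
  shows "cinner I (mat_app I (perm_mat \<sigma>) f) g = cinner I f (\<lambda>j. g (\<sigma> j))"
  by (simp only: cinner_perm_mat_app[OF assms]) (simp only: cinner_def)

lemma cinner_oracle:
  assumes "2 \<le> p" "a \<in> heis p n"
  shows "cinner (idxset p n N) (mat_app (idxset p n N) (qoracle p n a) f) g =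
    cinner (idxset p n N) f (\<lambda>j. g (act p n a (fst j), snd j))"
  unfolding qoracle_perm
  by (subst cinner_perm_shift) (use assms in \<open>simp_all add: bij_oracle[unfolded case_prod_unfold] finite_idxset case_prod_unfold\<close>)

lemma sum_idxset:
  assumes "bij_betw g L {..<N}"
  shows "(\<Sum>i\<in>idxset p n N. F i) = (\<Sum>v\<in>vecs p n. \<Sum>u\<in>L. F (v, g u))"
  unfolding idxset_def sum.cartesian_product[symmetric, of "\<lambda>x y. F (x, y)", simplified]
  by (intro sum.cong refl sum.reindex_bij_betw[OF assms, symmetric])

text \<open>The final states divided by \<open>sqrt \<Lambda>\<close> satisfy the hypothesis of
  \<open>povm_from_frame\<close>. Since they come from unit vectors, outcome \<open>a\<close> then
  has weight at least \<open>1 / \<Lambda>\<close> on the final state of \<open>a\<close>.\<close>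

lemma frame_algorithm:
  assumes p: "2 \<le> p" and N: "1 \<le> N" and \<psi>: "(\<Sum>i\<in>idxset p n N. (cmod (\<psi> i))\<^sup>2) = 1"
    and U: "\<And>k. k < t \<Longrightarrow> unitary_on (idxset p n N) (U k)" and L: "0 < \<Lambda>"
    and fr: "\<And>f. (\<Sum>a\<in>heis p n. (cmod (cinner (idxset p n N) (run p n N \<psi> U a t) f))\<^sup>2)
       \<le> \<Lambda> * (\<Sum>i\<in>idxset p n N. (cmod (f i))\<^sup>2)"
  shows "\<exists>E. is_query_alg p n t N \<psi> U E \<and> 1 / \<Lambda> \<le> success_prob p n t N \<psi> U E"
proof -
  let ?I = "idxset p n N" and ?G = "heis p n" and ?R = "\<lambda>a. run p n N \<psi> U a t"
  define \<mu> where "\<mu> = (\<lambda>a i. ?R a i / complex_of_real (sqrt \<Lambda>))"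
  have \<mu>: "(cmod (cinner ?I (\<mu> a) f))\<^sup>2 = (cmod (cinner ?I (?R a) f))\<^sup>2 / \<Lambda>" for a f
  proof -
    have "cinner ?I (\<mu> a) f = cinner ?I (?R a) f / complex_of_real (sqrt \<Lambda>)"
      unfolding cinner_def \<mu>_def by (simp add: sum_divide_distrib)
    then show ?thesis using L by (simp add: norm_divide power_divide)
  qed
  \<comment> \<open>The identity matrix is chosen as the outcome that absorbs the deficit of the
    POVM.\<close>
  have "heis_mat n (\<lambda>_. 0) (\<lambda>_. 0) \<in> ?G" using p by (intro heis_mat_in_heis zero_in_zvec) auto
  moreover have "(\<Sum>a\<in>?G. (cmod (cinner ?I (\<mu> a) f))\<^sup>2) \<le> (\<Sum>i\<in>?I. (cmod (f i))\<^sup>2)" for f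
    unfolding \<mu> sum_divide_distrib[symmetric] using fr[of f] L by (simp add: field_simps)
  ultimately obtain E where E: "povm_on ?I ?G E"
    and Em: "\<And>a f. a \<in> ?G \<Longrightarrow> (cmod (cinner ?I (\<mu> a) f))\<^sup>2 \<le> Re (cinner ?I f (mat_app ?I (E a) f))"
    using povm_from_frame[of ?I ?G "heis_mat n (\<lambda>_. 0) (\<lambda>_. 0)" \<mu>] finite_idxset[of p n N] finite_heis[OF p, of n] p
    by fastforce
  have alg: "is_query_alg p n t N \<psi> U E"
    using N \<psi> U E unfolding is_query_alg_def by simp
  have "1 / \<Lambda> \<le> Re (cinner ?I (?R a) (mat_app ?I (E a) (?R a)))" if a: "a \<in> ?G" for a
  proof -
    have "cinner ?I (?R a) (?R a) = 1"
      unfolding cinner_self run_norm[OF p a alg order_refl] by simp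
    then show ?thesis using Em[OF a, of "?R a"] unfolding \<mu> by simp
  qed
  then have "(\<Sum>a\<in>?G. 1 / \<Lambda>) \<le> (\<Sum>a\<in>?G. Re (cinner ?I (?R a) (mat_app ?I (E a) (?R a))))"
    by (rule sum_mono)
  then have "1 / \<Lambda> \<le> success_prob p n t N \<psi> U E"
    unfolding success_prob_def card_heis[OF p] sum_constant using p by (simp add: field_simps)
  with alg show ?thesis by blast
qed

text \<open>One outcome weighs at most as much as all outcomes together, which is 1. This turns the
  bound from below for two queries into an equality.\<close>

lemma success_prob_le_1:
  assumes p: "2 \<le> p" and alg: "is_query_alg p n t N \<psi> U E"
  shows "success_prob p n t N \<psi> U E \<le> 1"
proof -
  let ?I = "idxset p n N" and ?G = "heis p n" and ?R = "\<lambda>a. run p n N \<psi> U a t"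
  have povm: "povm_on ?I ?G E" using alg by (simp add: is_query_alg_def)
  have "Re (cinner ?I (?R a) (mat_app ?I (E a) (?R a))) \<le> 1" if a: "a \<in> ?G" for a
  proof -
    have "Re (cinner ?I (?R a) (mat_app ?I (E a) (?R a))) \<le> (\<Sum>b\<in>?G. Re (cinner ?I (?R a) (mat_app ?I (E b) (?R a))))"
      using povm by (intro member_le_sum[OF a] finite_heis[OF p]) (auto simp: povm_on_def psd_on_def)
    also have "\<dots> = 1"
      using povm_sum[OF povm] run_norm[OF p a alg order_refl] finite_idxset[of p n N] p by simp
    finally show ?thesis .
  qed
  then have "(\<Sum>a\<in>?G. Re (cinner ?I (?R a) (mat_app ?I (E a) (?R a)))) \<le> (\<Sum>a\<in>?G. 1)"
    by (rule sum_mono)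
  then show ?thesis
    unfolding success_prob_def card_heis[OF p] sum_constant using p by (simp add: field_simps)
qed

text \<open>The action on the coordinates other than 0, which depends on \<open>y\<close> but not on
  \<open>r\<close>.\<close>

definition lower_act :: "nat \<Rightarrow> nat \<Rightarrow> (nat \<Rightarrow> nat) \<Rightarrow> (nat \<Rightarrow> nat) \<Rightarrow> nat \<Rightarrow> nat" where
  "lower_act p n y b = (\<lambda>i. if i \<in> {1..n} then (b i + y i * b (n + 1)) mod p else b i)"

lemma zvec_pos: "b \<in> zvec p J \<Longrightarrow> 0 < p"
  by (auto simp: zvec_def intro: le_less_trans[OF le0])

lemma lower_act_in: "b \<in> zvec p {1..n+1} \<Longrightarrow> lower_act p n y b \<in> zvec p {1..n+1}"
  using zvec_pos[of b p "{1..n+1}"] by (auto simp: zvec_def lower_act_def)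

lemma act_eq_lower_act:
  assumes b: "b \<in> zvec p {1..n+1}" and z: "z < p"
  shows "act p n (heis_mat n r y) (b(0 := z)) = (lower_act p n y b)(0 := (z + (\<Sum>j=1..n+1. r j * b j)) mod p)"
proof -
  have "b(0 := z) \<in> vecs p n" unfolding vecs_zvec by (rule zvec_upd[OF b z])
  moreover have "(\<Sum>j=1..n+1. r j * (b(0 := z)) j) = (\<Sum>j=1..n+1. r j * b j)"
    by (intro sum.cong) auto
  ultimately show ?thesis by (auto simp: act_heis_mat lower_act_def fun_eq_iff)
qed

text \<open>
  Phase kickback: \<open>a\<close> shifts the coordinate \<open>0\<close>, so a character in that coordinate turns the
  shift into a scalar factor.
\<close>

lemma sum_act_phase:
  assumes b: "b \<in> zvec p {1..n+1}" 
  shows "(\<Sum>z<p. zchar p (\<kappa> * int z) * F (act p n (heis_mat n r y) (b(0 := z)))) =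
    (\<Sum>w<p. zchar p (\<kappa> * int w) * F ((lower_act p n y b)(0 := w))) * zchar p (- (\<kappa> * zdot {1..n+1} r b))"
proof -
  define m where "m = (\<Sum>j=1..n+1. r j * b j)"
  have m: "zdot {1..n+1} r b = int m" by (simp add: m_def zdot_def)
  have "0 < p" using b by (rule zvec_pos)
  have "(\<Sum>z<p. zchar p (\<kappa> * int z) * F (act p n (heis_mat n r y) (b(0 := z)))) =
    (\<Sum>z<p. zchar p (\<kappa> * int ((z + m) mod p)) * F ((lower_act p n y b)(0 := (z + m) mod p)) * zchar p (- (\<kappa> * int m)))"
  proof (intro sum.cong refl)
    fix z assume z: "z \<in> {..<p}"
    have "zchar p (\<kappa> * int ((z + m) mod p)) = zchar p (\<kappa> * (int z + int m))"
      by (intro zchar_cong) (simp add: of_nat_mod mod_mult_right_eq)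
    then have "zchar p (\<kappa> * int ((z + m) mod p)) * zchar p (- (\<kappa> * int m)) = zchar p (\<kappa> * int z)"
      by (simp only: zchar_add[symmetric]) (simp add: algebra_simps)
    then show "zchar p (\<kappa> * int z) * F (act p n (heis_mat n r y) (b(0 := z))) =
      zchar p (\<kappa> * int ((z + m) mod p)) * F ((lower_act p n y b)(0 := (z + m) mod p)) * zchar p (- (\<kappa> * int m))"
      using act_eq_lower_act[OF b, of z r y] z by (simp add: m_def mult_ac)
  qed
  also have "\<dots> = (\<Sum>w<p. zchar p (\<kappa> * int w) * F ((lower_act p n y b)(0 := w)) * zchar p (- (\<kappa> * int m)))"
    by (rule sum_shift_mod[OF \<open>0 < p\<close>])
  finally show ?thesis unfolding m by (simp only: sum_distrib_right)
qed

lemma phase_sum_le: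
  "(cmod (\<Sum>w<p. zchar p (\<kappa> * int w) * x w))\<^sup>2 \<le> real p * (\<Sum>w<p. (cmod (x w))\<^sup>2)"
  using norm_sum_square_le[of "{..<p}" "\<lambda>w. zchar p (\<kappa> * int w)" x] by simp

text \<open>If the last coordinate of \<open>b\<close> is 0, every \<open>y\<close> fixes
  \<open>b\<close> and the point is counted \<open>p ^ n\<close> times; otherwise, \<open>p\<close>
  being prime, distinct \<open>y\<close> give distinct images and each point is counted at most
  once. The weights 1 and \<open>p ^ n\<close> equalise the two cases, which is why the squared
  amplitudes of the query state have this ratio.\<close>

lemma sum_lower_act_le:
  assumes pr: "prime p" and b: "b \<in> zvec p {1..n+1}" and G: "\<And>t. 0 \<le> G t"
  shows "(if b (n + 1) = 0 then 1 else real p ^ n) * (\<Sum>y\<in>zvec p {1..n}. G (lower_act p n y b)) \<le> real p ^ n * (\<Sum>t\<in>zvec p {1..n+1}. G t)"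
proof -
  have p: "0 < p" using pr by (simp add: prime_gt_0_nat)
  have fz: "finite (zvec p {1..n+1})" by (simp add: finite_zvec p)
  show ?thesis
  proof (cases "b (n + 1) = 0")
    case True
    have "lower_act p n y b = b" for y
      using True b by (auto simp: lower_act_def fun_eq_iff zvec_def)
    moreover have "G b \<le> (\<Sum>t\<in>zvec p {1..n+1}. G t)"
      using G by (intro member_le_sum[OF b] fz) auto
    ultimately show ?thesis using True p by (simp add: card_zvec mult_left_mono)
  next
    case False
    have "inj_on (\<lambda>y. lower_act p n y b) (zvec p {1..n})"
    proof (rule inj_onI)
      fix y y' assume y: "y \<in> zvec p {1..n}" and y': "y' \<in> zvec p {1..n}" and eq: "lower_act p n y b = lower_act p n y' b"
      show "y = y'"
      proof (rule zvec_eqI[OF y y'])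
        fix j assume j: "j \<in> {1..n}"
        have "(b j + y j * b (n + 1)) mod p = (b j + y' j * b (n + 1)) mod p"
          using fun_cong[OF eq, of j] j by (simp add: lower_act_def)
        then have "int (b j + y j * b (n + 1)) mod int p = int (b j + y' j * b (n + 1)) mod int p"
          by (metis of_nat_mod)
        then have "int p dvd (int (y j) - int (y' j)) * int (b (n + 1))"
          by (simp add: mod_eq_dvd_iff algebra_simps)
        moreover have "\<not> p dvd b (n + 1)"
          using False b nat_dvd_not_less[of "b (n + 1)" p] by (auto simp: zvec_def)
        ultimately show "int p dvd int (y j) - int (y' j)"
          using pr by (simp add: prime_dvd_mult_iff)
      qed
    qed
    then have "(\<Sum>y\<in>zvec p {1..n}. G (lower_act p n y b)) = (\<Sum>t\<in>(\<lambda>y. lower_act p n y b) ` zvec p {1..n}. G t)"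
      by (simp add: sum.reindex)
    also have "\<dots> \<le> (\<Sum>t\<in>zvec p {1..n+1}. G t)"
      using G lower_act_in[OF b] by (intro sum_mono2 fz) auto
    finally show ?thesis using False by (simp add: mult_left_mono)
  qed
qed

lemma single_query_lower_bound:
  assumes pr: "prime p"
  shows "\<exists>N \<psi> U E. is_query_alg p n 1 N \<psi> U E \<and>
    real (span_dim p n) / real (p ^ (2 * n + 1)) \<le> success_prob p n 1 N \<psi> U E"
proof -
  have p: "2 \<le> p" using pr by (rule prime_ge_2_nat)
  then have p0: "0 < p" by simp
  define L where "L = zvec p {1..n+1}"
  define N where "N = card L"
  define D where "D = real (span_dim p n)"
  have "0 < (p ^ (n + 1) - p ^ n + 1) * p ^ n" using p0 by simp
  then have D: "0 < D" unfolding D_def span_dim_def by (simp only: of_nat_0_less_iff trans_less_add1)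
  have fL: "finite L" unfolding L_def by (simp add: finite_zvec p0)
  have cL: "card L = p ^ (n + 1)" unfolding L_def by (simp add: card_zvec p0)
  have N1: "1 \<le> N" unfolding N_def cL using p0 by simp
  obtain g where g: "bij_betw g L {..<N}"
    using ex_bij_betw_finite_nat[OF fL] unfolding N_def atLeast0LessThan by blast
  define gi where "gi = inv_into L g"
  have gi: "gi (g u) = u" if "u \<in> L" for u
    unfolding gi_def using g that by (simp add: bij_betw_def)
  define e where "e = (\<lambda>_. 0 :: nat)(n + 1 := 1)"
  \<comment> \<open>The vector queried under label \<open>u\<close>. Vectors supported on coordinate
    0 are fixed by the whole group, so label 0 is reassigned to the last unit vector
    \<open>e\<close>.\<close>
  define b where "b = (\<lambda>u. if u = (\<lambda>_. 0) then e else u)"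
  have eL: "e \<in> L" using p unfolding e_def L_def zvec_def by auto
  have bL: "b u \<in> L" if "u \<in> L" for u using that eL by (simp add: b_def)
  have L0: "u 0 = 0" if "u \<in> L" for u using that by (simp add: L_def zvec_def)
  have L0': "u(0 := 0) = u" if "u \<in> L" for u using L0[OF that] by (simp add: fun_eq_iff)
  define w where "w = (\<lambda>u. if b u (n + 1) = 0 then 1 else real p ^ n)"
  \<comment> \<open>The normalisation: each label carries \<open>p\<close> phases, and the weights
    \<open>w\<close> add up to \<open>D\<close>.\<close>
  define A where "A = (\<lambda>u. sqrt (w u / (real p * D)))"
  \<comment> \<open>Switching off the phase for label 0 makes the query of \<open>e\<close>
    classical and keeps its kickback frequency at 0.\<close>
  define \<kappa> where "\<kappa> = (\<lambda>u :: nat \<Rightarrow> nat. if u = (\<lambda>_. 0) then 0 else 1 :: int)"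
  define \<psi> where "\<psi> = (\<lambda>(v, k). if v(0 := 0) = b (gi k) then of_real (A (gi k)) * zchar p (- (\<kappa> (gi k) * int (v 0))) else 0)"
  have w0: "0 \<le> w u" for u by (simp add: w_def)
  have A2: "(A u)\<^sup>2 = w u / (real p * D)" for u
    unfolding A_def using w0[of u] D by simp
  have \<psi>: "\<psi> (t(0 := z), g u) = (if t = b u then of_real (A u) * zchar p (- (\<kappa> u * int z)) else 0)"
    if "t \<in> L" "u \<in> L" for t u z
    unfolding \<psi>_def using that by (simp add: gi L0')
  have sumI: "(\<Sum>i\<in>idxset p n N. F i) = (\<Sum>u\<in>L. \<Sum>t\<in>L. \<Sum>z<p. F (t(0 := z), g u))" for F :: "idx \<Rightarrow> 'x :: comm_monoid_add"
  proof -
    have "(\<Sum>i\<in>idxset p n N. F i) = (\<Sum>u\<in>L. \<Sum>v\<in>vecs p n. F (v, g u))"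
      by (subst sum_idxset[OF g]) (rule sum.swap)
    then show ?thesis by (simp only: sum_vecs L_def)
  qed
  have sum\<psi>: "(\<Sum>t\<in>L. \<Sum>z<p. cnj (\<psi> (t(0 := z), g u)) * H t z) = of_real (A u) * (\<Sum>z<p. zchar p (\<kappa> u * int z) * H (b u) z)"
    if u: "u \<in> L" for u and H :: "(nat \<Rightarrow> nat) \<Rightarrow> nat \<Rightarrow> complex"
  proof -
    have "(\<Sum>t\<in>L. \<Sum>z<p. cnj (\<psi> (t(0 := z), g u)) * H t z) =
      (\<Sum>t\<in>L. if t = b u then of_real (A u) * (\<Sum>z<p. zchar p (\<kappa> u * int z) * H t z) else 0)"
      by (intro sum.cong refl) (auto simp: \<psi> u cnj_zchar sum_distrib_left mult_ac)
    then show ?thesis using fL bL[OF u] by simp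
  qed
  \<comment> \<open>The total weight counts \<open>freqs\<close>: the labels in \<open>?K\<close>
    have \<open>p ^ n\<close> indices \<open>Some q\<close> each, the others a single index
    \<open>None\<close>.\<close>
  have sw: "(\<Sum>u\<in>L. w u) = D"
  proof -
    let ?K = "{u \<in> L. u (n + 1) \<noteq> 0 \<or> u = (\<lambda>_. 0)}"
    have K: "w u = (if u \<in> ?K then real p ^ n else 1)" if "u \<in> L" for u
      using that by (auto simp: w_def b_def e_def)
    have "(\<Sum>u\<in>L. w u) = (\<Sum>u\<in>?K. w u) + (\<Sum>u\<in>L - ?K. w u)"
      by (subst add.commute) (rule sum.subset_diff, use fL in auto)
    also have "\<dots> = (\<Sum>u\<in>?K. real p ^ n) + (\<Sum>u\<in>L - ?K. 1)"
      using K by (intro arg_cong2[of _ _ _ _ "(+)"] sum.cong refl) auto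
    also have "L - ?K = zvec p {1..n} - {\<lambda>_. 0}"
      unfolding L_def zvec_last[of p n] by auto
    also have "(\<Sum>u\<in>?K. real p ^ n) + (\<Sum>u\<in>zvec p {1..n} - {\<lambda>_. 0}. 1) =
      real (card ?K * p ^ n + card (zvec p {1..n} - {\<lambda>_. 0}))"
      by simp
    also have "card ?K * p ^ n + card (zvec p {1..n} - {\<lambda>_. 0}) = span_dim p n"
      unfolding L_def card_zero_or_last[OF p0] span_dim_def using p0
      by (simp add: card_zvec card_Diff_singleton zero_in_zvec)
    finally show ?thesis unfolding D_def .
  qed
  have unit: "(\<Sum>i\<in>idxset p n N. (cmod (\<psi> i))\<^sup>2) = 1"
  proof -
    have "complex_of_real (\<Sum>i\<in>idxset p n N. (cmod (\<psi> i))\<^sup>2) = 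
      (\<Sum>u\<in>L. \<Sum>t\<in>L. \<Sum>z<p. cnj (\<psi> (t(0 := z), g u)) * \<psi> (t(0 := z), g u))"
      unfolding of_real_sum complex_norm_square sumI by (simp only: mult.commute)
    also have "\<dots> = (\<Sum>u\<in>L. of_real (A u) * (\<Sum>z<p. zchar p (\<kappa> u * int z) * \<psi> ((b u)(0 := z), g u)))"
      by (intro sum.cong refl sum\<psi>)
    also have "\<dots> = (\<Sum>u\<in>L. of_real (w u / D))"
    proof (intro sum.cong refl)
      fix u assume u: "u \<in> L"
      have "zchar p (\<kappa> u * int z) * \<psi> ((b u)(0 := z), g u) = of_real (A u)" for z
        using zchar_add[of p "\<kappa> u * int z" "- (\<kappa> u * int z)"] unfolding \<psi>[OF bL[OF u] u] by simp
      then have "of_real (A u) * (\<Sum>z<p. zchar p (\<kappa> u * int z) * \<psi> ((b u)(0 := z), g u)) = complex_of_real (real p * (A u)\<^sup>2)"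
        by (simp add: power2_eq_square)
      then show "of_real (A u) * (\<Sum>z<p. zchar p (\<kappa> u * int z) * \<psi> ((b u)(0 := z), g u)) = complex_of_real (w u / D)"
        unfolding A2 using p0 by simp
    qed
    also have "\<dots> = of_real ((\<Sum>u\<in>L. w u) / D)" by (simp add: sum_divide_distrib)
    finally show ?thesis using D unfolding sw of_real_eq_iff by simp
  qed
  define U where "U = (\<lambda>k :: nat. perm_mat (\<lambda>i. i))"
  have fI: "finite (idxset p n N)" by (rule finite_idxset[OF p0])
  have U: "unitary_on (idxset p n N) (U k)" for k
    unfolding U_def using fI by (intro perm_mat_unitary) (auto simp: bij_betw_def)
  have fr: "(\<Sum>a\<in>heis p n. (cmod (cinner (idxset p n N) (run p n N \<psi> U a 1) f))\<^sup>2)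
       \<le> (real (p ^ (2 * n + 1)) / D) * (\<Sum>i\<in>idxset p n N. (cmod (f i))\<^sup>2)" for f
  proof -
    \<comment> \<open>The component of \<open>f\<close> in label \<open>u\<close> along the phase
      state over \<open>t\<close>.\<close>
    define W where "W = (\<lambda>u t. \<Sum>z<p. zchar p (\<kappa> u * int z) * f (t(0 := z), g u))"
    have inner: "cinner (idxset p n N) (run p n N \<psi> U (heis_mat n r y) 1) f =
        (\<Sum>u\<in>L. of_real (A u) * W u (lower_act p n y (b u)) * zchar p (- zdot {1..n+1} r u))"
      if ry: "r \<in> zvec p {1..n+1}" "y \<in> zvec p {1..n}" for r y
    proof -
      have "cinner (idxset p n N) (run p n N \<psi> U (heis_mat n r y) 1) f =
        cinner (idxset p n N) \<psi> (\<lambda>j. f (act p n (heis_mat n r y) (fst j), snd j))"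
        using fI cinner_oracle[OF p heis_mat_in_heis[OF p ry]] by (simp add: U_def cinner_perm_shift bij_betw_def)
      also have "\<dots> = (\<Sum>u\<in>L. \<Sum>t\<in>L. \<Sum>z<p. cnj (\<psi> (t(0 := z), g u)) * f (act p n (heis_mat n r y) (t(0 := z)), g u))"
        unfolding cinner_def sumI by simp
      also have "\<dots> = (\<Sum>u\<in>L. of_real (A u) * (\<Sum>z<p. zchar p (\<kappa> u * int z) * f (act p n (heis_mat n r y) ((b u)(0 := z)), g u)))"
        by (intro sum.cong refl sum\<psi>)
      also have "\<dots> = (\<Sum>u\<in>L. of_real (A u) * W u (lower_act p n y (b u)) * zchar p (- zdot {1..n+1} r u))"
      proof (intro sum.cong refl)
        fix u assume u: "u \<in> L"
        \<comment> \<open>Both sides vanish for \<open>u = 0\<close>, so the labels carry pairwise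
          distinct frequencies \<open>u\<close> and Parseval applies in \<open>r\<close>.\<close>
        have "\<kappa> u * zdot {1..n+1} r (b u) = zdot {1..n+1} r u"
          by (simp add: \<kappa>_def b_def zdot_def)
        then show "of_real (A u) * (\<Sum>z<p. zchar p (\<kappa> u * int z) * f (act p n (heis_mat n r y) ((b u)(0 := z)), g u)) =
          of_real (A u) * W u (lower_act p n y (b u)) * zchar p (- zdot {1..n+1} r u)"
          using sum_act_phase[OF bL[OF u, unfolded L_def], of "\<kappa> u" "\<lambda>v. f (v, g u)" r y]
          by (simp add: W_def mult.assoc)
      qed
      finally show ?thesis .
    qed
    have Wle: "(cmod (W u t))\<^sup>2 \<le> real p * (\<Sum>z<p. (cmod (f (t(0 := z), g u)))\<^sup>2)" for u t
      unfolding W_def by (rule phase_sum_le)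
    \<comment> \<open>For fixed \<open>y\<close> the sum over \<open>r\<close> is evaluated by
      Parseval; then for fixed \<open>u\<close> the sum over \<open>y\<close> is bounded by
      \<open>sum_lower_act_le\<close>, and finally \<open>W\<close> by Cauchy-Schwarz.\<close>
    have "(\<Sum>a\<in>heis p n. (cmod (cinner (idxset p n N) (run p n N \<psi> U a 1) f))\<^sup>2) =
      (\<Sum>y\<in>zvec p {1..n}. \<Sum>r\<in>L. (cmod (\<Sum>u\<in>L. of_real (A u) * W u (lower_act p n y (b u)) * zchar p (- zdot {1..n+1} r u)))\<^sup>2)"
      unfolding sum_heis[OF p] by (subst sum.swap) (simp only: inner L_def cong: sum.cong)
    also have "\<dots> = (\<Sum>y\<in>zvec p {1..n}. real p ^ (n + 1) * (\<Sum>u\<in>L. (cmod (of_real (A u) * W u (lower_act p n y (b u))))\<^sup>2))"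
      unfolding L_def by (subst parseval[OF p0]) simp_all
    also have "\<dots> = real p ^ (n + 1) * (\<Sum>u\<in>L. \<Sum>y\<in>zvec p {1..n}. (cmod (of_real (A u) * W u (lower_act p n y (b u))))\<^sup>2)"
      unfolding sum_distrib_left[symmetric] by (subst sum.swap) (rule refl)
    also have "\<dots> = real p ^ (n + 1) * (\<Sum>u\<in>L. (w u * (\<Sum>y\<in>zvec p {1..n}. (cmod (W u (lower_act p n y (b u))))\<^sup>2)) / (real p * D))"
      by (simp add: norm_mult power_mult_distrib A2 sum_distrib_left sum_divide_distrib)
    also have "\<dots> \<le> real p ^ (n + 1) * (\<Sum>u\<in>L. (real p ^ n * (\<Sum>t\<in>L. (cmod (W u t))\<^sup>2)) / (real p * D))"
      using D p0 bL unfolding w_def L_def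
      by (intro mult_left_mono sum_mono divide_right_mono sum_lower_act_le[OF pr]) auto
    also have "\<dots> \<le> real p ^ (n + 1) * (\<Sum>u\<in>L. (real p ^ n * (\<Sum>t\<in>L. real p * (\<Sum>z<p. (cmod (f (t(0 := z), g u)))\<^sup>2))) / (real p * D))"
      using D p0 by (intro mult_left_mono sum_mono divide_right_mono Wle) auto
    also have "\<dots> = (real p ^ (n + 1) * real p ^ n / D) * (\<Sum>i\<in>idxset p n N. (cmod (f i))\<^sup>2)"
      unfolding sumI using p0 by (simp add: sum_distrib_left[symmetric] sum_divide_distrib[symmetric])
    also have "real p ^ (n + 1) * real p ^ n = real (p ^ (2 * n + 1))"
      by (simp add: power_add mult_2)
    finally show ?thesis .
  qed
  have \<Lambda>: "0 < real (p ^ (2 * n + 1)) / D" using D p0 by simp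
  have "\<exists>E. is_query_alg p n 1 N \<psi> U E \<and> 1 / (real (p ^ (2 * n + 1)) / D) \<le> success_prob p n 1 N \<psi> U E"
    by (rule frame_algorithm[OF p N1 unit U \<Lambda> fr])
  then show ?thesis unfolding D_def by auto
qed

text \<open>After the first query one register holds the last column of the matrix, so different
  pairs \<open>(z, y)\<close> occupy disjoint slices of the space. Within a slice, Parseval in
  \<open>x\<close> shows that the states of different \<open>x\<close> share the squared norm of
  \<open>f\<close> with constant 1.\<close>

lemma two_query_algorithm:
  assumes pr: "prime p"
  shows "\<exists>N \<psi> U E. is_query_alg p n 2 N \<psi> U E \<and> 1 \<le> success_prob p n 2 N \<psi> U E"
proof -
  have p: "2 \<le> p" using pr by (rule prime_ge_2_nat)
  then have p0: "0 < p" by simp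
  define X where "X = vecs p n"
  define N where "N = card X"
  have fX: "finite X" unfolding X_def by (rule finite_vecs[OF p0])
  define e where "e = (\<lambda>_. 0 :: nat)(n + 1 := 1)"
  have eX: "e \<in> X" using p unfolding e_def X_def vecs_def by auto
  have N1: "1 \<le> N" unfolding N_def using eX fX by (auto simp: Suc_le_eq card_gt_0_iff)
  obtain g where g: "bij_betw g X {..<N}"
    using ex_bij_betw_finite_nat[OF fX] unfolding N_def atLeast0LessThan by blast
  define gi where "gi = inv_into X g"
  have gi: "gi (g u) = u" if "u \<in> X" for u
    unfolding gi_def using g that by (simp add: bij_betw_def)
  have giX: "gi k \<in> X" "g (gi k) = k" if "k < N" for k
    using g that bij_betw_inv_into_right[OF g] inv_into_into[of k g X] unfolding gi_def bij_betw_def by auto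
  have gN: "g u < N" if "u \<in> X" for u using g that by (auto simp: bij_betw_def)
  define s where "s = real p ^ (n + 1)"
  have s0: "0 < s" using p0 by (simp add: s_def)
  \<comment> \<open>Uniform over the \<open>p ^ (n + 1)\<close> vectors with last coordinate 0. On
    these neither \<open>y\<close> nor \<open>z\<close> acts, so the second query reveals exactly
    \<open>x\<close>.\<close>
  define B where "B = (\<lambda>u :: nat \<Rightarrow> nat. if u (n + 1) = 0 then zchar p (- int (u 0)) / of_real (sqrt s) else 0)"
  define \<psi> where "\<psi> = (\<lambda>(v, k). if v = e then B (gi k) else 0)"
  \<comment> \<open>Exchanges the two registers, with \<open>g\<close> identifying the ancilla
    labels with vectors.\<close>
  define sw where "sw = (\<lambda>(v, k). (gi k, g v))"
  define U where "U = (\<lambda>k :: nat. if k = 0 then perm_mat sw else perm_mat (\<lambda>i. i))"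
  let ?I = "idxset p n N"
  have fI: "finite ?I" by (rule finite_idxset[OF p0])
  have swI: "bij_betw sw ?I ?I"
    by (rule bij_betw_byWitness[where f' = sw]) (auto simp: sw_def idxset_def gi giX gN X_def[symmetric])
  have idI: "bij_betw (\<lambda>i. i) ?I ?I" by (simp add: bij_betw_def)
  have U: "unitary_on ?I (U k)" for k
    unfolding U_def using perm_mat_unitary[OF fI swI] perm_mat_unitary[OF fI idI] by simp
  have sumI: "(\<Sum>i\<in>?I. F i) = (\<Sum>v\<in>X. \<Sum>u\<in>X. F (v, g u))" for F :: "idx \<Rightarrow> 'x :: comm_monoid_add"
    unfolding X_def by (rule sum_idxset[OF g[unfolded X_def]])
  have sum\<psi>: "(\<Sum>i\<in>?I. cnj (\<psi> i) * H (fst i) (snd i)) = (\<Sum>u\<in>X. cnj (B u) * H e (g u))" for H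
  proof -
    have "(\<Sum>i\<in>?I. cnj (\<psi> i) * H (fst i) (snd i)) = (\<Sum>v\<in>X. if v = e then (\<Sum>u\<in>X. cnj (B u) * H v (g u)) else 0)"
      unfolding sumI by (intro sum.cong refl) (simp add: \<psi>_def gi)
    then show ?thesis using fX eX by simp
  qed
  have zl: "t \<in> zvec p {1..n} \<longleftrightarrow> t \<in> zvec p {1..n+1} \<and> t (n + 1) = 0" for t
    unfolding zvec_last[of p n] by simp
  \<comment> \<open>The factor \<open>1 * int z\<close> keeps the shape of
    \<open>sum_act_phase\<close> at \<open>\<kappa> = 1\<close>.\<close>
  have sumB: "(\<Sum>u\<in>X. cnj (B u) * H u) = (\<Sum>t\<in>zvec p {1..n}. \<Sum>z<p. zchar p (1 * int z) * H (t(0 := z)) / of_real (sqrt s))" for H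
  proof -
    have "(\<Sum>u\<in>X. cnj (B u) * H u) = (\<Sum>t\<in>zvec p {1..n+1}. \<Sum>z<p. cnj (B (t(0 := z))) * H (t(0 := z)))"
      unfolding X_def by (rule sum_vecs)
    also have "\<dots> = (\<Sum>t\<in>zvec p {1..n}. \<Sum>z<p. cnj (B (t(0 := z))) * H (t(0 := z)))"
    proof (rule sum.mono_neutral_right)
      show "finite (zvec p {1..n+1})" by (simp add: finite_zvec p0)
      show "zvec p {1..n} \<subseteq> zvec p {1..n+1}" by (rule zvec_mono) simp
      show "\<forall>t\<in>zvec p {1..n+1} - zvec p {1..n}. (\<Sum>z<p. cnj (B (t(0 := z))) * H (t(0 := z))) = 0"
      proof
        fix t assume "t \<in> zvec p {1..n+1} - zvec p {1..n}"
        then have "t (n + 1) \<noteq> 0" using zl[of t] by (simp only: Diff_iff simp_thms) (elim conjE, simp)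
        then show "(\<Sum>z<p. cnj (B (t(0 := z))) * H (t(0 := z))) = 0" by (simp add: B_def)
      qed
    qed
    also have "\<dots> = (\<Sum>t\<in>zvec p {1..n}. \<Sum>z<p. zchar p (1 * int z) * H (t(0 := z)) / of_real (sqrt s))"
    proof (intro sum.cong refl)
      fix t z assume "t \<in> zvec p {1..n}"
      then have "t (n + 1) = 0" using zl[of t] by (simp only: Diff_iff simp_thms)
      then show "cnj (B (t(0 := z))) * H (t(0 := z)) = zchar p (1 * int z) * H (t(0 := z)) / of_real (sqrt s)"
        by (simp add: B_def cnj_zchar)
    qed
    finally show ?thesis .
  qed
  have unit: "(\<Sum>i\<in>?I. (cmod (\<psi> i))\<^sup>2) = 1"
  proof -
    have "complex_of_real (\<Sum>i\<in>?I. (cmod (\<psi> i))\<^sup>2) = (\<Sum>i\<in>?I. cnj (\<psi> i) * \<psi> (fst i, snd i))"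
      unfolding of_real_sum complex_norm_square by (simp add: mult.commute)
    also have "\<dots> = (\<Sum>u\<in>X. cnj (B u) * B u)"
      unfolding sum\<psi>[of "\<lambda>v k. \<psi> (v, k)"] by (intro sum.cong refl) (simp add: \<psi>_def gi)
    also have "\<dots> = (\<Sum>t\<in>zvec p {1..n}. \<Sum>z<p. zchar p (1 * int z) * B (t(0 := z)) / of_real (sqrt s))"
      by (rule sumB)
    also have "\<dots> = (\<Sum>t\<in>zvec p {1..n}. \<Sum>z<p. of_real (1 / s))"
    proof (intro sum.cong refl)
      fix t z assume "t \<in> zvec p {1..n}"
      then have "t (n + 1) = 0" using zl[of t] by (simp only: Diff_iff simp_thms)
      then have "B (t(0 := z)) = zchar p (- int z) / of_real (sqrt s)" by (simp add: B_def)
      moreover have "zchar p (int z) * zchar p (- int z) = 1" by (simp flip: zchar_add)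
      moreover have "complex_of_real (sqrt s) * of_real (sqrt s) = of_real s"
        using s0 by (simp flip: of_real_mult)
      ultimately show "zchar p (1 * int z) * B (t(0 := z)) / of_real (sqrt s) = of_real (1 / s)" by simp
    qed
    also have "\<dots> = complex_of_real (real p ^ n * (real p / s))" using p0 by (simp add: card_zvec)
    also have "real p ^ n * (real p / s) = 1" using p0 by (simp add: s_def)
    finally show ?thesis by (simp only: of_real_eq_iff of_real_1 of_real_eq_1_iff)
  qed
  \<comment> \<open>The vector with entries \<open>z\<close>, \<open>y\<close>, 1, which is the last
    column of the hidden matrix.\<close>
  define lab where "lab = (\<lambda>z y. (y(n + 1 := 1))(0 := z) :: nat \<Rightarrow> nat)"
  have act_e: "act p n (heis_mat n (x(n + 1 := z)) y) e = lab z y"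
    if "z < p" "y \<in> zvec p {1..n}" for x z y
  proof -
    have 1: "(\<Sum>j=1..n+1. (x(n + 1 := z)) j * e j) = (\<Sum>j=1..n+1. if j = n + 1 then z else 0)"
      by (intro sum.cong) (auto simp: e_def)
    show ?thesis
      unfolding act_heis_mat[OF eX[unfolded X_def]] 1 using that
      by (auto simp: fun_eq_iff e_def lab_def zvec_def)
  qed
  have labX: "lab z y \<in> X" if "z < p" "y \<in> zvec p {1..n}" for z y
    using that p by (auto simp: lab_def X_def vecs_def zvec_def)
  have inner: "cinner ?I (run p n N \<psi> U (heis_mat n (x(n + 1 := z)) y) 2) f =
     (\<Sum>t\<in>zvec p {1..n}. (\<Sum>w<p. zchar p (1 * int w) * f (t(0 := w), g (lab z y))) / of_real (sqrt s) * zchar p (- zdot {1..n} x t))"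
    if x: "x \<in> zvec p {1..n}" and z: "z < p" and y: "y \<in> zvec p {1..n}" for x z y f
  proof -
    let ?a = "heis_mat n (x(n + 1 := z)) y"
    have S: "{1..n+1} = insert (n + 1) {1..n}" by auto
    have a: "?a \<in> heis p n"
      using zvec_upd[OF x z, of "n + 1"] y by (intro heis_mat_in_heis[OF p]) (simp_all only: S)
    have "cinner ?I (run p n N \<psi> U ?a 2) f =
      cinner ?I \<psi> (\<lambda>j. f (act p n ?a (fst (sw (act p n ?a (fst j), snd j))), snd (sw (act p n ?a (fst j), snd j))))"
      by (simp only: numeral_2_eq_2 run.simps U_def nat.simps if_True if_False simp_thms fst_conv snd_conv
        cinner_perm_shift[OF fI idI] cinner_perm_shift[OF fI swI] cinner_oracle[OF p a])
    also have "\<dots> = (\<Sum>u\<in>X. cnj (B u) * f (act p n ?a u, g (act p n ?a e)))"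
      unfolding cinner_def sum\<psi>[of "\<lambda>v k. f (act p n ?a (fst (sw (act p n ?a v, k))), snd (sw (act p n ?a v, k)))"]
      by (intro sum.cong refl) (simp add: sw_def gi)
    also have "\<dots> = (\<Sum>t\<in>zvec p {1..n}. \<Sum>w<p. zchar p (1 * int w) * f (act p n ?a (t(0 := w)), g (lab z y)) / of_real (sqrt s))"
      unfolding sumB act_e[OF z y] ..
    also have "\<dots> = (\<Sum>t\<in>zvec p {1..n}. (\<Sum>w<p. zchar p (1 * int w) * f (t(0 := w), g (lab z y))) / of_real (sqrt s) * zchar p (- zdot {1..n} x t))"
    proof (intro sum.cong refl)
      fix t assume t: "t \<in> zvec p {1..n}"
      then have t1: "t \<in> zvec p {1..n+1}" "t (n + 1) = 0" using zl[of t] by (simp_all only: simp_thms)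
      have "lower_act p n y t = t" using t1 by (auto simp: lower_act_def fun_eq_iff zvec_def)
      moreover have "zdot {1..n+1} (x(n + 1 := z)) t = zdot {1..n} (x(n + 1 := z)) t"
        unfolding zdot_def S using t1(2) by simp
      moreover have "zdot {1..n} (x(n + 1 := z)) t = zdot {1..n} x t"
        unfolding zdot_def by (intro sum.cong) auto
      ultimately show "(\<Sum>w<p. zchar p (1 * int w) * f (act p n ?a (t(0 := w)), g (lab z y)) / of_real (sqrt s)) =
        (\<Sum>w<p. zchar p (1 * int w) * f (t(0 := w), g (lab z y))) / of_real (sqrt s) * zchar p (- zdot {1..n} x t)"
        using sum_act_phase[OF t1(1), of 1 "\<lambda>v. f (v, g (lab z y))" "x(n + 1 := z)" y]
        by (simp add: sum_divide_distrib[symmetric])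
    qed
    finally show ?thesis .
  qed
  have fr: "(\<Sum>a\<in>heis p n. (cmod (cinner ?I (run p n N \<psi> U a 2) f))\<^sup>2) \<le> 1 * (\<Sum>i\<in>?I. (cmod (f i))\<^sup>2)" for f
  proof -
    have S: "{1..n+1} = insert (n + 1) {1..n}" by auto
    have part: "(\<Sum>x\<in>zvec p {1..n}. (cmod (cinner ?I (run p n N \<psi> U (heis_mat n (x(n + 1 := z)) y) 2) f))\<^sup>2)
       \<le> (\<Sum>v\<in>X. (cmod (f (v, g (lab z y))))\<^sup>2)" if z: "z < p" and y: "y \<in> zvec p {1..n}" for z y
    proof -
      define W where "W = (\<lambda>t. (\<Sum>w<p. zchar p (1 * int w) * f (t(0 := w), g (lab z y))))"
      have W: "(cmod (W t))\<^sup>2 \<le> real p * (\<Sum>w<p. (cmod (f (t(0 := w), g (lab z y))))\<^sup>2)" for t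
        unfolding W_def by (rule phase_sum_le)
      have "(\<Sum>x\<in>zvec p {1..n}. (cmod (cinner ?I (run p n N \<psi> U (heis_mat n (x(n + 1 := z)) y) 2) f))\<^sup>2) =
         (\<Sum>x\<in>zvec p {1..n}. (cmod (\<Sum>t\<in>zvec p {1..n}. W t / of_real (sqrt s) * zchar p (- zdot {1..n} x t)))\<^sup>2)"
        unfolding W_def by (intro sum.cong refl) (simp only: inner[OF _ z y])
      also have "\<dots> = real p ^ n * (\<Sum>t\<in>zvec p {1..n}. (cmod (W t / of_real (sqrt s)))\<^sup>2)"
        by (subst parseval[OF p0]) simp_all
      also have "\<dots> = real p ^ n / s * (\<Sum>t\<in>zvec p {1..n}. (cmod (W t))\<^sup>2)"
        using s0 by (simp add: norm_divide power_divide sum_divide_distrib[symmetric])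
      also have "\<dots> \<le> real p ^ n / s * (\<Sum>t\<in>zvec p {1..n}. real p * (\<Sum>w<p. (cmod (f (t(0 := w), g (lab z y))))\<^sup>2))"
        using s0 by (intro mult_left_mono sum_mono W) auto
      also have "\<dots> = (\<Sum>t\<in>zvec p {1..n}. \<Sum>w<p. (cmod (f (t(0 := w), g (lab z y))))\<^sup>2)"
        using p0 by (simp add: s_def sum_distrib_left[symmetric])
      also have "\<dots> \<le> (\<Sum>t\<in>zvec p {1..n+1}. \<Sum>w<p. (cmod (f (t(0 := w), g (lab z y))))\<^sup>2)"
        by (intro sum_mono2 sum_nonneg zvec_mono zero_le_power2) (use p0 in \<open>auto simp: finite_zvec\<close>)
      also have "\<dots> = (\<Sum>v\<in>X. (cmod (f (v, g (lab z y))))\<^sup>2)"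
        unfolding X_def by (rule sum_vecs[symmetric])
      finally show ?thesis .
    qed
    \<comment> \<open>Distinct pairs \<open>(z, y)\<close> use distinct slices, so the bounds for
      the slices add up to at most the full squared norm of \<open>f\<close>.\<close>
    have inj: "inj_on (\<lambda>(z, y). lab z y) ({..<p} \<times> zvec p {1..n})"
    proof (rule inj_onI, clarify)
      fix z y z' y' assume *: "y \<in> zvec p {1..n}" "y' \<in> zvec p {1..n}" "lab z y = lab z' y'"
      have "z = z'" using fun_cong[OF *(3), of 0] by (simp add: lab_def)
      moreover have "y i = y' i" for i
        using fun_cong[OF *(3), of i] *(1,2) by (cases "i \<in> {1..n}") (auto simp: lab_def zvec_def split: if_splits)
      ultimately show "z = z' \<and> y = y'" by auto
    qed
    have "(\<Sum>a\<in>heis p n. (cmod (cinner ?I (run p n N \<psi> U a 2) f))\<^sup>2) =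
      (\<Sum>x\<in>zvec p {1..n}. \<Sum>z<p. \<Sum>y\<in>zvec p {1..n}. (cmod (cinner ?I (run p n N \<psi> U (heis_mat n (x(n + 1 := z)) y) 2) f))\<^sup>2)"
      unfolding sum_heis[OF p] S by (rule sum_zvec_insert) simp
    also have "\<dots> = (\<Sum>z<p. \<Sum>x\<in>zvec p {1..n}. \<Sum>y\<in>zvec p {1..n}. (cmod (cinner ?I (run p n N \<psi> U (heis_mat n (x(n + 1 := z)) y) 2) f))\<^sup>2)"
      by (rule sum.swap)
    also have "\<dots> = (\<Sum>z<p. \<Sum>y\<in>zvec p {1..n}. \<Sum>x\<in>zvec p {1..n}. (cmod (cinner ?I (run p n N \<psi> U (heis_mat n (x(n + 1 := z)) y) 2) f))\<^sup>2)"
      by (intro sum.cong refl sum.swap)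
    also have "\<dots> \<le> (\<Sum>z<p. \<Sum>y\<in>zvec p {1..n}. \<Sum>v\<in>X. (cmod (f (v, g (lab z y))))\<^sup>2)"
      by (intro sum_mono part) auto
    also have "\<dots> = (\<Sum>u\<in>(\<lambda>(z, y). lab z y) ` ({..<p} \<times> zvec p {1..n}). \<Sum>v\<in>X. (cmod (f (v, g u)))\<^sup>2)"
      unfolding sum.reindex[OF inj] by (subst sum.cartesian_product) (simp add: case_prod_unfold)
    also have "\<dots> \<le> (\<Sum>u\<in>X. \<Sum>v\<in>X. (cmod (f (v, g u)))\<^sup>2)"
      using labX by (intro sum_mono2 fX sum_nonneg) auto
    also have "\<dots> = (\<Sum>i\<in>?I. (cmod (f i))\<^sup>2)"
      unfolding sumI by (rule sum.swap)
    finally show ?thesis by simp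
  qed
  have "\<exists>E. is_query_alg p n 2 N \<psi> U E \<and> 1 / 1 \<le> success_prob p n 2 N \<psi> U E"
    by (rule frame_algorithm[OF p N1 unit U zero_less_one fr])
  then show ?thesis by auto
qed

theorem theorem19:
  fixes p n :: nat
  assumes "prime p" and "n \<ge> 1"
  shows "(\<exists>N \<psi> U E. is_query_alg p n 1 N \<psi> U E \<and>
            success_prob p n 1 N \<psi> U E
              = 1 - 1 / real p + 2 / real p ^ (n + 1) - 1 / real p ^ (2 * n + 1))
       \<and> (\<forall>N \<psi> U E. is_query_alg p n 1 N \<psi> U E \<longrightarrow>
            success_prob p n 1 N \<psi> U E
              \<le> 1 - 1 / real p + 2 / real p ^ (n + 1) - 1 / real p ^ (2 * n + 1))
       \<and> (\<exists>N \<psi> U E. is_query_alg p n 2 N \<psi> U E \<and> success_prob p n 2 N \<psi> U E = 1)"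
proof (intro conjI allI impI)
  note opt = span_dim_eq[OF prime_gt_0_nat[OF assms(1)], of n]
  show upper: "success_prob p n 1 N \<psi> U E
      \<le> 1 - 1 / real p + 2 / real p ^ (n + 1) - 1 / real p ^ (2 * n + 1)"
    if "is_query_alg p n 1 N \<psi> U E" for N \<psi> U E
    using single_query_upper_bound[OF assms(1) that] unfolding opt .
  obtain N \<psi> U E where alg: "is_query_alg p n 1 N \<psi> U E"
    and "real (span_dim p n) / real (p ^ (2 * n + 1)) \<le> success_prob p n 1 N \<psi> U E"
    using single_query_lower_bound[OF assms(1)] by blast
  with upper[OF alg] show "\<exists>N \<psi> U E. is_query_alg p n 1 N \<psi> U E \<and> success_prob p n 1 N \<psi> U E
      = 1 - 1 / real p + 2 / real p ^ (n + 1) - 1 / real p ^ (2 * n + 1)"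
    unfolding opt by (blast intro: order_antisym)
  obtain N \<psi> U E where alg: "is_query_alg p n 2 N \<psi> U E" and "1 \<le> success_prob p n 2 N \<psi> U E"
    using two_query_algorithm[OF assms(1)] by blast
  with success_prob_le_1[OF prime_ge_2_nat[OF assms(1)] alg]
  show "\<exists>N \<psi> U E. is_query_alg p n 2 N \<psi> U E \<and> success_prob p n 2 N \<psi> U E = 1"
    by (blast intro: order_antisym)
qed

end
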